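(* Let $n,d\in\mathbb{N}$ and let $f\in\mathbb{R}[x_1,\dots,x_n]$ have degree at most $d$ and be positive on $[-1,1]^n$, with minimum and maximum values $0<f_{\min}<f_{\max}$ on $[-1,1]^n$. Let $r\in\mathbb{N}$, $r\ge 2$, satisfy \[ \frac{r}{\log r}\ge 10\sqrt{35}\left(1+\tfrac{1}{\sqrt2}\right)d^{5/2}\quad\text{and}\quad \frac{r}{\log r}\ge 150\,d^{5/2}\frac{f_{\max}}{f_{\min}}. \] Then $f+\tilde\epsilon\in\mathcal Q(1-x_1^2,\dots,1-x_n^2)_{2nt}$, where $t=O(r)$ and $\tilde\epsilon=O(\|f\|_{1,\mathrm{cheb}}\log(r)/r^2)$. In particular, one may take \[ t=104r,\qquad \tilde\epsilon=e\cdot n\left(\tfrac72 d^{9/2}+14\right)\|f\|_{1,\mathrm{cheb}}\,\frac{\log r}{r^2}. \]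
   Context: $\Sigma[x]_r$ denotes the cone of sums of squares of polynomials in $x=(x_1,\dots,x_n)$ of total degree at most $r$; $\mathcal Q(1-x_1^2,\dots,1-x_n^2)_r=\Sigma[x]_r+\sum_{i=1}^n(1-x_i^2)\Sigma[x]_{r-2}$. $T_k(x)=\cos(k\arccos x)$ is the Chebyshev polynomial of the first kind; for $\alpha\in\mathbb{N}_0^n$, $T_\alpha(x)=\prod_i T_{\alpha_i}(x_i)$; for $p=\sum_\alpha p_\alpha T_\alpha$, $\|p\|_{1,\mathrm{cheb}}=\sum_\alpha|p_\alpha|$. $\log$ is the natural logarithm, $e$ is Euler's number. *)

theory Defs
  imports "HOL-Analysis.Analysis"
begin

(* Points of R^n are represented as x :: nat => real, only coordinates 0..n-1 matter. *)

(* Chebyshev polynomials of the first kind, T_k(cos t) = cos (k t) *)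
fun cheb :: "nat \<Rightarrow> real \<Rightarrow> real" where
  "cheb 0 x = 1"
| "cheb (Suc 0) x = x"
| "cheb (Suc (Suc k)) x = 2 * x * cheb (Suc k) x - cheb k x"

definition mindex :: "nat \<Rightarrow> nat \<Rightarrow> (nat \<Rightarrow> nat) set" where
  "mindex n k = {\<alpha>. (\<forall>i\<ge>n. \<alpha> i = 0) \<and> (\<Sum>i<n. \<alpha> i) \<le> k}"

definition chebT :: "nat \<Rightarrow> (nat \<Rightarrow> nat) \<Rightarrow> (nat \<Rightarrow> real) \<Rightarrow> real" where
  "chebT n \<alpha> x = (\<Prod>i<n. cheb (\<alpha> i) (x i))"

definition chebpoly :: "nat \<Rightarrow> nat \<Rightarrow> ((nat \<Rightarrow> nat) \<Rightarrow> real) \<Rightarrow> (nat \<Rightarrow> real) \<Rightarrow> real" where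
  "chebpoly n d c x = (\<Sum>\<alpha>\<in>mindex n d. c \<alpha> * chebT n \<alpha> x)"

definition cheb_norm1 :: "nat \<Rightarrow> nat \<Rightarrow> ((nat \<Rightarrow> nat) \<Rightarrow> real) \<Rightarrow> real" where
  "cheb_norm1 n d c = (\<Sum>\<alpha>\<in>mindex n d. \<bar>c \<alpha>\<bar>)"

definition cube :: "nat \<Rightarrow> (nat \<Rightarrow> real) set" where
  "cube n = {x. \<forall>i<n. -1 \<le> x i \<and> x i \<le> 1}"

definition polyfun :: "nat \<Rightarrow> nat \<Rightarrow> ((nat \<Rightarrow> real) \<Rightarrow> real) \<Rightarrow> bool" where
  "polyfun n k p \<longleftrightarrow> (\<exists>a :: (nat \<Rightarrow> nat) \<Rightarrow> real.
      \<forall>x. p x = (\<Sum>\<alpha>\<in>mindex n k. a \<alpha> * (\<Prod>i<n. x i ^ \<alpha> i)))"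

definition sos :: "nat \<Rightarrow> nat \<Rightarrow> ((nat \<Rightarrow> real) \<Rightarrow> real) \<Rightarrow> bool" where
  "sos n r g \<longleftrightarrow> (\<exists>ps :: ((nat \<Rightarrow> real) \<Rightarrow> real) list.
      (\<forall>p\<in>set ps. polyfun n (r div 2) p) \<and> (\<forall>x. g x = (\<Sum>p\<leftarrow>ps. (p x)^2)))"

definition qmod :: "nat \<Rightarrow> nat \<Rightarrow> ((nat \<Rightarrow> real) \<Rightarrow> real) \<Rightarrow> bool" where
  "qmod n r g \<longleftrightarrow> (\<exists>s0 (s :: nat \<Rightarrow> (nat \<Rightarrow> real) \<Rightarrow> real). sos n r s0 \<and>
      (\<forall>i<n. sos n (r - 2) (s i)) \<and>
      (\<forall>x. g x = s0 x + (\<Sum>i<n. (1 - (x i)^2) * s i x)))"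

end

theory Submission
  imports Defs
begin

text \<open>
  For \<open>L\<close> slightly larger than \<open>1\<close> there are nodes \<open>y\<^sub>l \<in> [- L, L]\<close> and univariate squares
  \<open>s\<^sub>l\<close> such that \<open>P\<^sub>k = (\<Sum>l. T\<^sub>k(y\<^sub>l) s\<^sub>l)\<close> approximates \<open>T\<^sub>k\<close> for \<open>k \<le> d\<close>. Tensorising over the
  coordinates turns \<open>f\<close> into \<open>F = (\<Sum>g. f(y\<^sub>g) \<Prod>i. s\<^sub>g\<^sub>i(x\<^sub>i))\<close>, a sum of squares as soon as
  \<open>f \<ge> 0\<close> on \<open>[- L, L]\<^sup>n\<close>; the hypothesis on \<open>fmax / fmin\<close> provides exactly this.
  The remainder \<open>f - F\<close> telescopes over the coordinates into products of univariate
  polynomials \<open>p\<close> carrying certificates for \<open>B\<^sup>2 - p\<^sup>2\<close>, and such certificates multiply.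

  The kernel is the square of the window \<open>A(u) = T\<^sub>M(h/2 + (1 + h/2) cos u)\<close>, made globally a
  square by using \<open>(A(\<theta> - \<phi>) + A(\<theta> + \<phi>))\<^sup>2\<close>. The cross terms are negligible because \<open>A\<close> is at
  most \<open>1\<close> off a neighbourhood of \<open>0\<close> but has mean square of a high power of \<open>r\<close>; the main terms
  multiply Chebyshev coefficients by factors \<open>1 - O(k\<^sup>2 log r / r\<^sup>2)\<close>.
\<close>

subsection \<open>Chebyshev polynomials\<close>

text \<open>\<open>chebU k\<close> is the second-kind polynomial usually written \<open>U\<^sub>k\<^sub>-\<^sub>1\<close>.\<close>
fun chebU :: "nat \<Rightarrow> real \<Rightarrow> real" where
  "chebU 0 x = 0"
| "chebU (Suc 0) x = 1"
| "chebU (Suc (Suc k)) x = 2 * x * chebU (Suc k) x - chebU k x"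

text \<open>One more multiplication by x + sqrt(x^2 - 1) in (x + sqrt(x^2 - 1))^k = T_k(x) +
  \<open>chebU k x\<close> * sqrt(x^2 - 1). The coupled one-step form permits plain induction on
  \<open>k\<close> from here on.\<close>

lemma cheb_chebU_Suc:
  "cheb (Suc k) x = x * cheb k x + (x\<^sup>2 - 1) * chebU k x \<and> chebU (Suc k) x = cheb k x + x * chebU k x"
proof (induction k x rule: cheb.induct)
  case (3 k x)
  have T: "cheb (Suc k) x = x * cheb k x + (x\<^sup>2 - 1) * chebU k x"
    and U: "chebU (Suc k) x = cheb k x + x * chebU k x" using 3 by auto
  show ?case unfolding cheb.simps(3) chebU.simps(3) T U
    by (simp add: algebra_simps power2_eq_square)
qed (simp_all add: power2_eq_square)

lemmas cheb_Suc = cheb_chebU_Suc[THEN conjunct1]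
lemmas chebU_Suc = cheb_chebU_Suc[THEN conjunct2]

text \<open>The norm of x + sqrt(x^2 - 1) is 1, hence so is that of its powers. In
  \<open>qbound_cheb\<close> the identity becomes an explicit certificate with weight 1 -
  x_i^2.\<close>

lemma cheb_Pell: "(cheb k x)\<^sup>2 - (x\<^sup>2 - 1) * (chebU k x)\<^sup>2 = 1"
proof (induction k)
  case (Suc k)
  have "(cheb (Suc k) x)\<^sup>2 - (x\<^sup>2 - 1) * (chebU (Suc k) x)\<^sup>2
        = (cheb k x)\<^sup>2 - (x\<^sup>2 - 1) * (chebU k x)\<^sup>2"
    unfolding cheb_Suc chebU_Suc by (simp add: algebra_simps power2_eq_square)
  then show ?case using Suc by simp
qed simp

lemma cheb_cos: "cheb k (cos t) = cos (real k * t)"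
proof (induction k "cos t" rule: cheb.induct)
  case (3 k)
  have "cos (real (Suc (Suc k)) * t) + cos (real k * t) = 2 * cos t * cos (real (Suc k) * t)"
  proof -
    have "(real (Suc (Suc k)) * t + real k * t) / 2 = real (Suc k) * t"
      "(real (Suc (Suc k)) * t - real k * t) / 2 = t"
      by (simp_all add: algebra_simps add_divide_distrib)
    then show ?thesis using cos_plus_cos[of "real (Suc (Suc k)) * t" "real k * t"] by simp
  qed
  with 3 show ?case by simp
qed simp_all

lemma abs_cheb_le_1:
  assumes "\<bar>z\<bar> \<le> 1" shows "\<bar>cheb k z\<bar> \<le> 1"
  using assms cheb_cos[of k "arccos z"] by (simp add: abs_le_iff)

lemma abs_chebU_le:
  assumes "\<bar>z\<bar> \<le> 1" shows "\<bar>chebU k z\<bar> \<le> k"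
proof (induction k)
  case (Suc k)
  have "\<bar>chebU (Suc k) z\<bar> \<le> \<bar>cheb k z\<bar> + \<bar>z\<bar> * \<bar>chebU k z\<bar>"
    unfolding chebU_Suc by (metis abs_mult abs_triangle_ineq)
  also have "\<dots> \<le> 1 + 1 * real k"
    using assms Suc by (intro add_mono mult_mono abs_cheb_le_1) auto
  finally show ?case by simp
qed simp

text \<open>The derivative of \<open>cheb (Suc k)\<close> involves that of \<open>chebU k\<close>,
  so both go through the induction together. The latter enters only multiplied by x^2 - 1, and that
  product obeys a division-free identity valid also at x = 1 and x = -1.\<close>

lemma DERIV_cheb_aux:
  "(cheb k has_real_derivative real k * chebU k x) (at x) \<and>
   (\<exists>D. (chebU k has_real_derivative D) (at x) \<and> (x\<^sup>2 - 1) * D = real k * cheb k x - x * chebU k x)"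
proof (induction k)
  case 0
  have "cheb 0 = (\<lambda>x. 1)" "chebU 0 = (\<lambda>x. 0)" by (auto simp: fun_eq_iff)
  then show ?case by (auto intro!: exI[of _ 0])
next
  case (Suc k)
  then obtain D where T: "(cheb k has_real_derivative real k * chebU k x) (at x)"
    and U: "(chebU k has_real_derivative D) (at x)"
    and D: "(x\<^sup>2 - 1) * D = real k * cheb k x - x * chebU k x" by blast
  have fT: "cheb (Suc k) = (\<lambda>x. x * cheb k x + (x\<^sup>2 - 1) * chebU k x)"
    and fU: "chebU (Suc k) = (\<lambda>x. cheb k x + x * chebU k x)"
    by (auto simp: fun_eq_iff cheb_Suc chebU_Suc)
  have "(cheb (Suc k) has_real_derivative
      (cheb k x + x * (real k * chebU k x)) + (2 * x * chebU k x + (x\<^sup>2 - 1) * D)) (at x)"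
    unfolding fT by (auto intro!: derivative_eq_intros T U)
  moreover have "(cheb k x + x * (real k * chebU k x)) + (2 * x * chebU k x + (x\<^sup>2 - 1) * D)
      = real (Suc k) * chebU (Suc k) x"
    unfolding D chebU_Suc by (simp add: algebra_simps)
  moreover have "(chebU (Suc k) has_real_derivative
      real k * chebU k x + (chebU k x + x * D)) (at x)"
    unfolding fU by (auto intro!: derivative_eq_intros T U)
  moreover have "(x\<^sup>2 - 1) * (real k * chebU k x + (chebU k x + x * D))
     = (x\<^sup>2 - 1) * (real k * chebU k x + chebU k x) + x * ((x\<^sup>2 - 1) * D)"
    by (simp add: algebra_simps)
  then have "(x\<^sup>2 - 1) * (real k * chebU k x + (chebU k x + x * D))
     = real (Suc k) * cheb (Suc k) x - x * chebU (Suc k) x"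
    unfolding D chebU_Suc cheb_Suc by (simp add: algebra_simps power2_eq_square)
  ultimately show ?case by auto
qed

lemmas DERIV_cheb = DERIV_cheb_aux[THEN conjunct1]

section \<open>Growth of Chebyshev polynomials beyond the unit interval\<close>

lemma cheb_ge_1:
  assumes "1 \<le> x" shows "1 \<le> cheb k x \<and> 0 \<le> chebU k x"
proof (induction k)
  case (Suc k)
  have "1 * 1 \<le> x * cheb k x" using Suc assms by (intro mult_mono) auto
  moreover have "0 \<le> (x\<^sup>2 - 1) * chebU k x" using Suc assms by (auto simp: one_le_power)
  moreover have "0 \<le> x * chebU k x" using Suc assms by auto
  ultimately show ?case unfolding cheb_Suc chebU_Suc using Suc by (intro conjI) linarith+
qed simp

lemma cheb_mono:
  assumes "1 \<le> x" "x \<le> y" shows "cheb k x \<le> cheb k y \<and> chebU k x \<le> chebU k y"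
proof (induction k)
  case (Suc k)
  have "x * cheb k x \<le> y * cheb k y" "x * chebU k x \<le> y * chebU k y"
    using Suc assms cheb_ge_1[of x k] by (auto intro!: mult_mono)
  moreover have "(x\<^sup>2 - 1) * chebU k x \<le> (y\<^sup>2 - 1) * chebU k y"
    using Suc assms cheb_ge_1[of x k]
    by (intro mult_mono) (auto simp: one_le_power power_mono)
  ultimately show ?case using Suc by (auto simp: cheb_Suc chebU_Suc)
qed simp

lemma cheb_uminus: "cheb k (- x) = (- 1) ^ k * cheb k x"
  by (induction k x rule: cheb.induct) (auto simp: algebra_simps)

lemma abs_cheb_le_cheb:
  assumes "1 \<le> L" "\<bar>y\<bar> \<le> L" shows "\<bar>cheb k y\<bar> \<le> cheb k L"
proof (cases "\<bar>y\<bar> \<le> 1")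
  case True
  then show ?thesis using abs_cheb_le_1[of y k] cheb_ge_1[of L k] assms by auto
next
  case False
  have "\<bar>cheb k y\<bar> = \<bar>cheb k \<bar>y\<bar>\<bar>"
    by (cases "y \<ge> 0") (auto simp: cheb_uminus abs_mult)
  also have "\<dots> = cheb k \<bar>y\<bar>" using cheb_ge_1[of "\<bar>y\<bar>" k] False by auto
  also have "\<dots> \<le> cheb k L" using cheb_mono[of "\<bar>y\<bar>" L k] assms False by auto
  finally show ?thesis .
qed

text \<open>For \<open>\<rho>\<close> = exp s this is T_k(cosh s) = cosh(k s); it makes the
  exponential growth beyond 1 explicit.\<close>

lemma cheb_Joukowsky:
  assumes "\<rho> \<noteq> 0" shows "cheb k ((\<rho> + 1 / \<rho>) / 2) = (\<rho> ^ k + 1 / \<rho> ^ k) / 2"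
proof (induction k "(\<rho> + 1 / \<rho>) / 2" rule: cheb.induct)
  case (3 k)
  have "cheb (Suc (Suc k)) ((\<rho> + 1 / \<rho>) / 2)
      = (\<rho> + 1 / \<rho>) * ((\<rho> ^ Suc k + 1 / \<rho> ^ Suc k) / 2) - (\<rho> ^ k + 1 / \<rho> ^ k) / 2"
    unfolding cheb.simps(3) 3 by simp
  also have "\<dots> = (\<rho> ^ Suc (Suc k) + 1 / \<rho> ^ Suc (Suc k)) / 2"
    using assms by (simp add: field_simps)
  finally show ?case .
qed simp_all

text \<open>Trades one factor T_M for U, which makes integration by parts applicable later. For z >
  1 the Pell identity gives sqrt(z^2 - 1) U <= T. For |z| <= 1 the left side is at most 1, and
  \<open>\<sigma> * real M\<close> absorbs a negative product T U.\<close>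

lemma cheb_power2_le:
  assumes "-1 \<le> z" "z\<^sup>2 - 1 \<le> \<sigma>\<^sup>2" "0 \<le> \<sigma>"
  shows "(cheb M z)\<^sup>2 \<le> 1 + \<sigma> * real M + \<sigma> * (cheb M z * chebU M z)"
proof (cases "z \<le> 1")
  case True
  then have z: "\<bar>z\<bar> \<le> 1" using assms by auto
  have "\<bar>cheb M z * chebU M z\<bar> \<le> 1 * real M"
    unfolding abs_mult by (intro mult_mono abs_cheb_le_1 abs_chebU_le z) auto
  then have "0 \<le> \<sigma> * (real M + cheb M z * chebU M z)" using assms by auto
  moreover have "(cheb M z)\<^sup>2 \<le> 1"
    using abs_cheb_le_1[OF z] by (simp add: abs_square_le_1)
  ultimately show ?thesis by (simp add: algebra_simps)
next
  case False
  define s where "s = sqrt (z\<^sup>2 - 1)"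
  have s0: "0 \<le> z\<^sup>2 - 1" using False by (simp add: one_le_power)
  then have s: "s\<^sup>2 = z\<^sup>2 - 1" "0 \<le> s" "s \<le> \<sigma>"
    by (simp_all add: s_def real_le_lsqrt assms)
  have T: "1 \<le> cheb M z" and U: "0 \<le> chebU M z" using cheb_ge_1[of z M] False by auto
  have p: "(cheb M z)\<^sup>2 = 1 + (s * chebU M z)\<^sup>2"
    using cheb_Pell[of M z] s by (simp add: power_mult_distrib)
  then have "s * chebU M z \<le> cheb M z"
    using T by (smt (verit) power2_le_imp_le)
  then have "(s * chebU M z) * (s * chebU M z) \<le> (\<sigma> * chebU M z) * cheb M z"
    using s U T by (intro mult_mono) auto
  then have "(cheb M z)\<^sup>2 \<le> 1 + \<sigma> * (cheb M z * chebU M z)"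
    using p by (simp add: power2_eq_square algebra_simps)
  moreover have "0 \<le> \<sigma> * real M" using assms by simp
  ultimately show ?thesis by linarith
qed

text \<open>By 1 - cos y = 2 sin(y/2)^2 this is the square of |sin(j x)| <= j |sin x|. It reduces
  the defects of all frequencies to that of frequency 1.\<close>

lemma one_minus_cos_multiple_le: "1 - cos (real j * u) \<le> (real j)\<^sup>2 * (1 - cos u)"
proof -
  have s: "\<bar>sin (real j * x)\<bar> \<le> real j * \<bar>sin x\<bar>" for x
  proof (induction j)
    case (Suc j)
    have "\<bar>sin (real (Suc j) * x)\<bar> \<le> \<bar>sin (real j * x)\<bar> * \<bar>cos x\<bar> + \<bar>cos (real j * x)\<bar> * \<bar>sin x\<bar>"
      using abs_triangle_ineq[of "sin (real j * x) * cos x" "cos (real j * x) * sin x"]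
      by (simp add: ring_distribs sin_add abs_mult add.commute mult.commute)
    also have "\<dots> \<le> \<bar>sin (real j * x)\<bar> * 1 + 1 * \<bar>sin x\<bar>"
      by (intro add_mono mult_mono) auto
    finally show ?case using Suc by (simp add: algebra_simps)
  qed simp
  have c: "1 - cos y = 2 * \<bar>sin (y / 2)\<bar>\<^sup>2" for y :: real
    using cos_double_sin[of "y/2"] by simp
  have "\<bar>sin (real j * (u / 2))\<bar>\<^sup>2 \<le> (real j * \<bar>sin (u / 2)\<bar>)\<^sup>2"
    by (intro power_mono s) auto
  then show ?thesis unfolding c[of u] c[of "real j * u"] by (simp add: power_mult_distrib)
qed

subsection \<open>Chebyshev expansions\<close>

text \<open>These are the univariate polynomials of degree at most \<open>D\<close>. The Chebyshev
  basis is chosen because its coefficients are averages over the circle and each basis element has a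
  certified bound.\<close>

definition cheb_span :: "nat \<Rightarrow> (real \<Rightarrow> real) \<Rightarrow> bool" where
  "cheb_span D g \<longleftrightarrow> (\<exists>a. \<forall>z. g z = (\<Sum>m\<le>D. a m * cheb m z))"

lemma cheb_span_add:
  assumes "cheb_span D f" "cheb_span D g" shows "cheb_span D (\<lambda>z. f z + g z)"
proof -
  obtain a b where "\<forall>z. f z = (\<Sum>m\<le>D. a m * cheb m z)" "\<forall>z. g z = (\<Sum>m\<le>D. b m * cheb m z)"
    using assms by (auto simp: cheb_span_def)
  then show ?thesis
    by (auto simp: cheb_span_def sum.distrib algebra_simps intro!: exI[of _ "\<lambda>m. a m + b m"])
qed

lemma cheb_span_cmult:
  assumes "cheb_span D f" shows "cheb_span D (\<lambda>z. c * f z)"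
proof -
  obtain a where "\<forall>z. f z = (\<Sum>m\<le>D. a m * cheb m z)" using assms by (auto simp: cheb_span_def)
  then show ?thesis
    by (auto simp: cheb_span_def sum_distrib_left mult.assoc intro!: exI[of _ "\<lambda>m. c * a m"])
qed

lemma cheb_span_diff:
  assumes "cheb_span D f" "cheb_span D g" shows "cheb_span D (\<lambda>z. f z - g z)"
  using cheb_span_add[OF assms(1) cheb_span_cmult[OF assms(2), of "-1"]] by simp

lemma cheb_span_cheb:
  assumes "k \<le> D" shows "cheb_span D (cheb k)"
proof -
  have "cheb k z = (\<Sum>m\<le>D. (if m = k then 1 else 0) * cheb m z)" for z
    using assms by (simp add: if_distrib[of "\<lambda>t. t * _"] cong: if_cong)
  then show ?thesis unfolding cheb_span_def by metis
qed

lemma cheb_span_const: "cheb_span D (\<lambda>z. c)"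
  using cheb_span_cmult[OF cheb_span_cheb[of 0 D], of c] by (simp add: fun_eq_iff)

lemma cheb_span_sum:
  assumes "\<And>i. i \<in> I \<Longrightarrow> cheb_span D (f i)" shows "cheb_span D (\<lambda>z. \<Sum>i\<in>I. f i z)"
  using assms by (induction I rule: infinite_finite_induct)
    (auto intro: cheb_span_const cheb_span_add)

lemma cheb_span_mono:
  assumes "cheb_span D f" "D \<le> E" shows "cheb_span E f"
proof -
  obtain a where a: "\<And>z. f z = (\<Sum>m\<le>D. a m * cheb m z)" using assms by (auto simp: cheb_span_def)
  have "cheb_span E (\<lambda>z. \<Sum>m\<le>D. a m * cheb m z)"
    using assms by (intro cheb_span_sum cheb_span_cmult cheb_span_cheb) auto
  then show ?thesis by (simp add: a[abs_def])
qed

lemma cheb_mult_cheb: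
  "m \<le> l \<Longrightarrow> cheb m z * cheb l z = (cheb (l + m) z + cheb (l - m) z) / 2"
proof (induction m z arbitrary: l rule: cheb.induct)
  case (2 x)
  then obtain l' where "l = Suc l'" by (cases l) auto
  then show ?case by simp
next
  case (3 k x)
  then obtain l' where l: "l = Suc (Suc k) + l'" by (metis le_iff_add)
  have "cheb (Suc k) x * cheb l x = (cheb (l + Suc k) x + cheb (l - Suc k) x) / 2"
    "cheb k x * cheb l x = (cheb (l + k) x + cheb (l - k) x) / 2"
    using 3 by auto
  then have "cheb (Suc (Suc k)) x * cheb l x = 2 * x * ((cheb (l + Suc k) x + cheb (l - Suc k) x) / 2)
     - (cheb (l + k) x + cheb (l - k) x) / 2"
    by (simp add: algebra_simps)
  also have "\<dots> = (cheb (l + Suc (Suc k)) x + cheb (l - Suc (Suc k)) x) / 2"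
  proof -
    have "cheb (l + Suc (Suc k)) x = 2 * x * cheb (l + Suc k) x - cheb (l + k) x" by simp
    moreover have "cheb (l - k) x = 2 * x * cheb (l - Suc k) x - cheb (l - Suc (Suc k)) x"
      by (simp add: l)
    ultimately show ?thesis by (simp add: field_simps)
  qed
  finally show ?case .
qed simp

lemma cheb_span_mult:
  assumes "cheb_span D f" "cheb_span E g" shows "cheb_span (D + E) (\<lambda>z. f z * g z)"
proof -
  obtain a b where a: "\<And>z. f z = (\<Sum>m\<le>D. a m * cheb m z)" and b: "\<And>z. g z = (\<Sum>m\<le>E. b m * cheb m z)"
    using assms by (auto simp: cheb_span_def)
  have *: "cheb_span (D + E) (\<lambda>z. cheb m z * cheb l z)" if "m \<le> D" "l \<le> E" for m l
  proof -
    have "cheb_span (D + E) (\<lambda>z. 1/2 * (cheb (l + m) z + cheb (nat \<bar>int l - int m\<bar>) z))"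
      using that by (intro cheb_span_cmult cheb_span_add cheb_span_cheb) auto
    moreover have "cheb m z * cheb l z = 1/2 * (cheb (l + m) z + cheb (nat \<bar>int l - int m\<bar>) z)" for z
    proof (cases "m \<le> l")
      case True
      then show ?thesis using cheb_mult_cheb[of m l z] by (simp add: nat_diff_distrib)
    next
      case False
      then have "nat \<bar>int l - int m\<bar> = m - l" by auto
      then show ?thesis using cheb_mult_cheb[of l m z] False by (simp add: mult.commute add.commute)
    qed
    ultimately show ?thesis by presburger
  qed
  have "f z * g z = (\<Sum>m\<le>D. \<Sum>l\<le>E. (a m * b l) * (cheb m z * cheb l z))" for z
    unfolding a b by (simp add: sum_product mult_ac)
  moreover have "cheb_span (D + E) (\<lambda>z. \<Sum>m\<le>D. \<Sum>l\<le>E. (a m * b l) * (cheb m z * cheb l z))"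
    by (intro cheb_span_sum cheb_span_cmult *) auto
  ultimately show ?thesis by simp
qed

lemma cheb_span_affine: "cheb_span k (\<lambda>z. cheb k (\<gamma> + \<beta> * z))"
proof (induction k "0::real" rule: cheb.induct)
  case 1 show ?case by (simp add: cheb_span_const)
next
  case 2
  have "cheb_span 1 (\<lambda>z. \<gamma> + \<beta> * cheb 1 z)"
    by (intro cheb_span_add cheb_span_const cheb_span_cmult cheb_span_cheb) auto
  then show ?case by simp
next
  case (3 k)
  have "cheb_span 1 (\<lambda>z. 2 * (\<gamma> + \<beta> * cheb 1 z))"
    by (intro cheb_span_add cheb_span_const cheb_span_cmult cheb_span_cheb) auto
  from cheb_span_mult[OF this 3(1)]
  have "cheb_span (Suc (Suc k)) (\<lambda>z. 2 * (\<gamma> + \<beta> * z) * cheb (Suc k) (\<gamma> + \<beta> * z))" by simp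
  moreover have "cheb_span (Suc (Suc k)) (\<lambda>z. cheb k (\<gamma> + \<beta> * z))"
    using 3(2) by (rule cheb_span_mono) auto
  ultimately show ?case unfolding cheb.simps by (rule cheb_span_diff)
qed

subsection \<open>Averages over equidistant points of the circle\<close>

definition node :: "nat \<Rightarrow> nat \<Rightarrow> real" where
  "node N i = 2 * pi * real i / real N"

text \<open>A trapezoidal rule replacing the integral over the circle: it is exact on trigonometric
  polynomials of degree below \<open>N\<close>, and it leaves finitely many nodes for the
  kernel.\<close>

definition avg :: "nat \<Rightarrow> (real \<Rightarrow> real) \<Rightarrow> real" where
  "avg N g = (\<Sum>i<N. g (node N i)) / real N"

lemma avg_add: "avg N (\<lambda>u. f u + g u) = avg N f + avg N g"
  by (simp add: avg_def sum.distrib add_divide_distrib)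

lemma avg_diff: "avg N (\<lambda>u. f u - g u) = avg N f - avg N g"
  by (simp add: avg_def sum_subtractf diff_divide_distrib)

lemma avg_cmult: "avg N (\<lambda>u. c * f u) = c * avg N f"
  by (simp add: avg_def sum_distrib_left)

lemma avg_const: "0 < N \<Longrightarrow> avg N (\<lambda>u. c) = c"
  by (simp add: avg_def)

lemma avg_sum: "avg N (\<lambda>u. \<Sum>i\<in>I. f i u) = (\<Sum>i\<in>I. avg N (f i))"
  unfolding avg_def by (subst sum.swap) (simp add: sum_divide_distrib)

lemma avg_mono: "(\<And>u. f u \<le> g u) \<Longrightarrow> avg N f \<le> avg N g"
  unfolding avg_def by (intro divide_right_mono sum_mono) auto

lemma avg_nonneg: "(\<And>u. 0 \<le> f u) \<Longrightarrow> 0 \<le> avg N f"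
  unfolding avg_def by (intro divide_nonneg_nonneg sum_nonneg) auto

lemma abs_avg_le: "\<bar>avg N f\<bar> \<le> avg N (\<lambda>u. \<bar>f u\<bar>)"
  unfolding avg_def by (simp add: divide_right_mono)

text \<open>The variance of |f| is nonnegative.\<close>

lemma avg_abs_le_sqrt:
  assumes "0 < N" shows "avg N (\<lambda>u. \<bar>f u\<bar>) \<le> sqrt (avg N (\<lambda>u. (f u)\<^sup>2))"
proof -
  define m where "m = avg N (\<lambda>u. \<bar>f u\<bar>)"
  have "0 \<le> avg N (\<lambda>u. (\<bar>f u\<bar> - m)\<^sup>2)" by (rule avg_nonneg) simp
  also have "(\<lambda>u. (\<bar>f u\<bar> - m)\<^sup>2) = (\<lambda>u. (f u)\<^sup>2 - (2 * m) * \<bar>f u\<bar> + m\<^sup>2)"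
    by (auto simp: power2_diff fun_eq_iff)
  also have "avg N \<dots> = avg N (\<lambda>u. (f u)\<^sup>2) - m\<^sup>2"
    using assms by (simp add: avg_add avg_diff avg_cmult avg_const flip: m_def) (simp add: power2_eq_square)
  finally show ?thesis by (intro real_le_rsqrt) (simp add: m_def)
qed

lemma avg_cos:
  assumes "\<bar>l\<bar> < int N"
  shows "avg N (\<lambda>u. cos (of_int l * u + \<alpha>)) = (if l = 0 then cos \<alpha> else 0)"
proof (cases "l = 0")
  case True
  then show ?thesis using assms by (simp add: avg_const)
next
  case False
  define h where "h = 2 * pi * of_int l / real N"
  have N: "0 < real N" using assms by auto
  \<comment> \<open>A discrete antiderivative: the factor 2 sin(h/2) makes the cosine sum telescope,
    and \<open>S\<close> takes the same value at \<open>N\<close> and 0 because N h is a multiple of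
    2 pi.\<close>
  define S where "S = (\<lambda>i::nat. sin ((real i - 1/2) * h + \<alpha>))"
  have "2 * sin (h / 2) * cos (of_int l * node N i + \<alpha>) = S (Suc i) - S i" for i
  proof -
    have "of_int l * node N i + \<alpha> = real i * h + \<alpha>" by (simp add: node_def h_def)
    then show ?thesis unfolding S_def
      by (simp add: sin_diff_sin algebra_simps add_divide_distrib diff_divide_distrib)
  qed
  then have "2 * sin (h / 2) * (\<Sum>i<N. cos (of_int l * node N i + \<alpha>)) = (\<Sum>i<N. S (Suc i) - S i)"
    by (simp add: sum_distrib_left)
  also have "\<dots> = S N - S 0" by (rule sum_lessThan_telescope)
  also have "(real N - 1/2) * h + \<alpha> = ((0 - 1/2) * h + \<alpha>) + 2 * pi * of_int l"
    using N by (simp add: h_def field_simps)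
  then have "S N = S 0"
  proof -
    assume "(real N - 1/2) * h + \<alpha> = ((0 - 1/2) * h + \<alpha>) + 2 * pi * of_int l"
    then have "S N = sin (((0 - 1/2) * h + \<alpha>) + 2 * pi * of_int l)" by (simp only: S_def)
    also have "\<dots> = sin ((0 - 1/2) * h + \<alpha>)"
      using sin_int_2pin[of l] cos_int_2pin[of l] by (simp only: sin_add) simp
    finally show ?thesis by (simp add: S_def)
  qed
  finally have "sin (h / 2) = 0 \<or> (\<Sum>i<N. cos (of_int l * node N i + \<alpha>)) = 0" by simp
  \<comment> \<open>Otherwise \<open>N\<close> would divide the nonzero \<open>l\<close>, whose
    modulus is below \<open>N\<close>.\<close>
  moreover have "sin (h / 2) \<noteq> 0"
  proof
    assume "sin (h / 2) = 0"
    then obtain i :: int where "h / 2 = of_int i * pi" by (auto simp: sin_zero_iff_int2)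
    then have "of_int l = (of_int i * real N :: real)" using N by (simp add: h_def field_simps)
    then have "l = i * int N" by (metis of_int_eq_iff of_int_mult of_int_of_nat_eq)
    then have "int N dvd l" by simp
    with assms False show False using dvd_imp_le_int[of l "int N"] by simp
  qed
  ultimately show ?thesis using False by (simp add: avg_def)
qed

lemma avg_cos_cos_shift:
  assumes "j + m < N"
  shows "avg N (\<lambda>u. cos (real j * u) * cos (real m * (u - \<theta>)))
    = cos (real j * \<theta>) * (if j = m then if j = 0 then 1 else 1 / 2 else 0)"
proof -
  have "cos (real j * u) * cos (real m * (u - \<theta>))
     = 1/2 * (cos (of_int (int j - int m) * u + real m * \<theta>) + cos (of_int (int j + int m) * u + - (real m * \<theta>)))" for u
    by (simp add: cos_times_cos algebra_simps)
  moreover have "avg N (\<lambda>u. cos (of_int (int j - int m) * u + real m * \<theta>))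
      = (if int j - int m = 0 then cos (real m * \<theta>) else 0)"
    using assms by (intro avg_cos) auto
  moreover have "avg N (\<lambda>u. cos (of_int (int j + int m) * u + - (real m * \<theta>)))
      = (if int j + int m = 0 then cos (- (real m * \<theta>)) else 0)"
    using assms by (intro avg_cos) auto
  ultimately have "avg N (\<lambda>u. cos (real j * u) * cos (real m * (u - \<theta>)))
    = 1/2 * ((if int j - int m = 0 then cos (real m * \<theta>) else 0)
           + (if int j + int m = 0 then cos (- (real m * \<theta>)) else 0))"
    by (simp only: avg_add avg_cmult)
  then show ?thesis by auto
qed

lemmas avg_cos_cos = avg_cos_cos_shift[where \<theta> = 0, simplified]

text \<open>Up to the factor 2 (1 if k = 0), the coefficient is the average of cos(k u) g(cos u).
  The frequencies that occur are at most 2 D, so \<open>N > 2 * D\<close> makes the discrete average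
  exact.\<close>

lemma cheb_coeff_avg:
  assumes g: "\<And>z. g z = (\<Sum>m\<le>D. a m * cheb m z)" and N: "2 * D < N" and k: "k \<le> D"
  shows "\<bar>a k\<bar> \<le> 2 * avg N (\<lambda>u. \<bar>g (cos u)\<bar>)"
proof -
  have "avg N (\<lambda>u. cos (real k * u) * g (cos u))
      = (\<Sum>m\<le>D. a m * avg N (\<lambda>u. cos (real k * u) * cos (real m * u)))"
    unfolding g cheb_cos sum_distrib_left avg_sum avg_cmult[symmetric]
    by (simp add: mult_ac)
  also have "\<dots> = (\<Sum>m\<le>D. if m = k then a k * (if k = 0 then 1 else 1/2) else 0)"
    using N k by (intro sum.cong) (auto simp: avg_cos_cos)
  also have "\<dots> = a k * (if k = 0 then 1 else 1/2)" using k by simp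
  finally have "\<bar>a k\<bar> * (if k = 0 then 1 else 1/2) = \<bar>avg N (\<lambda>u. cos (real k * u) * g (cos u))\<bar>"
    by (simp add: abs_mult)
  also have "\<dots> \<le> avg N (\<lambda>u. \<bar>cos (real k * u) * g (cos u)\<bar>)" by (rule abs_avg_le)
  also have "\<dots> \<le> avg N (\<lambda>u. \<bar>g (cos u)\<bar>)"
    by (rule avg_mono) (simp add: abs_mult mult_left_le_one_le)
  finally show ?thesis
    using avg_nonneg[of "\<lambda>u. \<bar>g (cos u)\<bar>" N] by (auto split: if_splits)
qed

lemma cheb_coeff_le:
  assumes g: "\<And>z. g z = (\<Sum>m\<le>D. a m * cheb m z)" and B: "\<And>z. \<bar>z\<bar> \<le> 1 \<Longrightarrow> \<bar>g z\<bar> \<le> B"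
    and k: "k \<le> D"
  shows "\<bar>a k\<bar> \<le> 2 * B"
proof -
  have "avg (2 * D + 1) (\<lambda>u. \<bar>g (cos u)\<bar>) \<le> avg (2 * D + 1) (\<lambda>u. B)"
    by (intro avg_mono B) simp
  with cheb_coeff_avg[OF g, of "2 * D + 1" k] k show ?thesis by (simp add: avg_const)
qed

subsection \<open>Polynomial functions and the truncated quadratic module\<close>

lemma finite_mindex: "finite (mindex n k)"
proof (rule finite_subset)
  show "mindex n k \<subseteq> {\<alpha>. \<forall>i. (i \<in> {..<n} \<longrightarrow> \<alpha> i \<in> {..k}) \<and> (i \<notin> {..<n} \<longrightarrow> \<alpha> i = 0)}"
  proof
    fix \<alpha> assume \<alpha>: "\<alpha> \<in> mindex n k"
    have "\<alpha> i \<le> k" if "i < n" for i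
    proof -
      have "\<alpha> i \<le> (\<Sum>i<n. \<alpha> i)" using that by (intro member_le_sum) auto
      then show ?thesis using \<alpha> by (auto simp: mindex_def)
    qed
    then show "\<alpha> \<in> {\<alpha>. \<forall>i. (i \<in> {..<n} \<longrightarrow> \<alpha> i \<in> {..k}) \<and> (i \<notin> {..<n} \<longrightarrow> \<alpha> i = 0)}"
      using \<alpha> by (simp add: mindex_def)
  qed
qed (rule finite_set_of_finite_funs; simp)

lemma polyfun_add:
  assumes "polyfun n k p" "polyfun n k q" shows "polyfun n k (\<lambda>x. p x + q x)"
proof -
  obtain a b where "\<forall>x. p x = (\<Sum>\<alpha>\<in>mindex n k. a \<alpha> * (\<Prod>i<n. x i ^ \<alpha> i))"
    "\<forall>x. q x = (\<Sum>\<alpha>\<in>mindex n k. b \<alpha> * (\<Prod>i<n. x i ^ \<alpha> i))"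
    using assms by (auto simp: polyfun_def)
  then show ?thesis
    by (auto simp: polyfun_def sum.distrib algebra_simps intro!: exI[of _ "\<lambda>\<alpha>. a \<alpha> + b \<alpha>"])
qed

lemma polyfun_cmult:
  assumes "polyfun n k p" shows "polyfun n k (\<lambda>x. c * p x)"
proof -
  obtain a where "\<forall>x. p x = (\<Sum>\<alpha>\<in>mindex n k. a \<alpha> * (\<Prod>i<n. x i ^ \<alpha> i))"
    using assms by (auto simp: polyfun_def)
  then show ?thesis
    by (auto simp: polyfun_def sum_distrib_left mult.assoc intro!: exI[of _ "\<lambda>\<alpha>. c * a \<alpha>"])
qed

lemma polyfun_diff:
  assumes "polyfun n k p" "polyfun n k q" shows "polyfun n k (\<lambda>x. p x - q x)"
  using polyfun_add[OF assms(1) polyfun_cmult[OF assms(2), of "-1"]] by simp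

lemma polyfun_monomial:
  assumes "\<alpha> \<in> mindex n k" shows "polyfun n k (\<lambda>x. \<Prod>i<n. x i ^ \<alpha> i)"
proof -
  have "(\<Prod>i<n. x i ^ \<alpha> i) = (\<Sum>\<beta>\<in>mindex n k. (if \<beta> = \<alpha> then 1 else 0) * (\<Prod>i<n. x i ^ \<beta> i))"
    for x :: "nat \<Rightarrow> real"
    using assms finite_mindex[of n k] by (simp add: if_distrib[of "\<lambda>t. t * _"] cong: if_cong)
  then show ?thesis
    unfolding polyfun_def by (intro exI[of _ "\<lambda>\<beta>. if \<beta> = \<alpha> then 1 else 0"]) blast
qed

lemma polyfun_const: "polyfun n k (\<lambda>x. c)"
proof -
  have "polyfun n k (\<lambda>x. c * (\<Prod>i<n. x i ^ (\<lambda>_. 0) i))"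
    by (intro polyfun_cmult polyfun_monomial) (simp add: mindex_def)
  then show ?thesis by simp
qed

lemma polyfun_sum:
  assumes "\<And>i. i \<in> I \<Longrightarrow> polyfun n k (f i)" shows "polyfun n k (\<lambda>x. \<Sum>i\<in>I. f i x)"
  using assms by (induction I rule: infinite_finite_induct)
    (auto intro: polyfun_const polyfun_add)

lemma polyfun_mono:
  assumes "polyfun n k p" "k \<le> l" shows "polyfun n l p"
proof -
  obtain a where a: "\<And>x. p x = (\<Sum>\<alpha>\<in>mindex n k. a \<alpha> * (\<Prod>i<n. x i ^ \<alpha> i))"
    using assms by (auto simp: polyfun_def)
  have "polyfun n l (\<lambda>x. \<Sum>\<alpha>\<in>mindex n k. a \<alpha> * (\<Prod>i<n. x i ^ \<alpha> i))"
    using assms(2) by (intro polyfun_sum polyfun_cmult polyfun_monomial) (auto simp: mindex_def)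
  then show ?thesis by (simp add: a[abs_def])
qed

lemma polyfun_coord:
  assumes "i < n" shows "polyfun n 1 (\<lambda>x. x i)"
proof -
  have "polyfun n 1 (\<lambda>x. \<Prod>j<n. x j ^ ((\<lambda>_. 0)(i := 1)) j)"
    using assms by (intro polyfun_monomial) (simp add: mindex_def)
  moreover have "(\<Prod>j<n. x j ^ ((\<lambda>_. 0)(i := 1)) j) = x i" for x :: "nat \<Rightarrow> real"
    using assms by (simp add: if_distrib[of "\<lambda>t. _ ^ t"] cong: if_cong)
  ultimately show ?thesis by simp
qed

lemma polyfun_mult:
  assumes "polyfun n k p" "polyfun n l q" shows "polyfun n (k + l) (\<lambda>x. p x * q x)"
proof -
  obtain a b where a: "\<And>x. p x = (\<Sum>\<alpha>\<in>mindex n k. a \<alpha> * (\<Prod>i<n. x i ^ \<alpha> i))"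
    and b: "\<And>x. q x = (\<Sum>\<beta>\<in>mindex n l. b \<beta> * (\<Prod>i<n. x i ^ \<beta> i))"
    using assms by (auto simp: polyfun_def)
  have "p x * q x = (\<Sum>\<alpha>\<in>mindex n k. \<Sum>\<beta>\<in>mindex n l.
      (a \<alpha> * b \<beta>) * (\<Prod>i<n. x i ^ (\<lambda>i. \<alpha> i + \<beta> i) i))" for x
    unfolding a b by (simp add: sum_product power_add prod.distrib mult_ac)
  moreover have "polyfun n (k + l) (\<lambda>x. \<Sum>\<alpha>\<in>mindex n k. \<Sum>\<beta>\<in>mindex n l.
      (a \<alpha> * b \<beta>) * (\<Prod>i<n. x i ^ (\<lambda>i. \<alpha> i + \<beta> i) i))"
    by (intro polyfun_sum polyfun_cmult polyfun_monomial)
      (auto simp: mindex_def sum.distrib intro: add_mono)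
  ultimately show ?thesis by presburger
qed

lemma polyfun_prod:
  assumes "\<And>i. i < m \<Longrightarrow> polyfun n k (f i)" shows "polyfun n (m * k) (\<lambda>x. \<Prod>i<m. f i x)"
  using assms
proof (induction m)
  case (Suc m)
  then have "polyfun n (m * k + k) (\<lambda>x. (\<Prod>i<m. f i x) * f m x)" by (intro polyfun_mult) auto
  then show ?case by (simp add: add.commute mult.commute)
qed (simp add: polyfun_const)

lemma polyfun_cheb:
  assumes i: "i < n"
  shows "polyfun n k (\<lambda>x. cheb k (x i / L)) \<and> polyfun n (k - 1) (\<lambda>x. chebU k (x i / L))"
proof (induction k rule: induct_nat_012)
  case 0
  show ?case by (simp add: polyfun_const)
next
  case 1
  show ?case using polyfun_cmult[OF polyfun_coord[OF i], of "1 / L"] by (simp add: polyfun_const)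
next
  case (ge2 k)
  have x: "polyfun n 1 (\<lambda>x. 2 * (x i / L))"
    using polyfun_cmult[OF polyfun_coord[OF i], of "2 / L"] by simp
  have "polyfun n (1 + Suc k) (\<lambda>x. 2 * (x i / L) * cheb (Suc k) (x i / L))"
    "polyfun n (1 + (Suc k - 1)) (\<lambda>x. 2 * (x i / L) * chebU (Suc k) (x i / L))"
    using ge2 polyfun_mult[OF x] by blast+
  then show ?case
    using ge2 by (auto intro!: polyfun_diff elim: polyfun_mono)
qed

lemma polyfun_cheb_span:
  assumes "i < n" "cheb_span D g" shows "polyfun n D (\<lambda>x. g (x i))"
proof -
  obtain a where a: "\<And>z. g z = (\<Sum>m\<le>D. a m * cheb m z)" using assms by (auto simp: cheb_span_def)
  have "polyfun n D (\<lambda>x. \<Sum>m\<le>D. a m * cheb m (x i / 1))"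
    by (intro polyfun_sum polyfun_cmult polyfun_mono[OF conjunct1[OF polyfun_cheb]] assms) auto
  then show ?thesis by (simp add: a)
qed

section \<open>Closure properties of truncated sums of squares and quadratic modules\<close>

lemma sos_add:
  assumes "sos n r f" "sos n r g" shows "sos n r (\<lambda>x. f x + g x)"
proof -
  obtain ps qs where "\<forall>p\<in>set ps. polyfun n (r div 2) p" "\<forall>x. f x = (\<Sum>p\<leftarrow>ps. (p x)\<^sup>2)"
    "\<forall>p\<in>set qs. polyfun n (r div 2) p" "\<forall>x. g x = (\<Sum>p\<leftarrow>qs. (p x)\<^sup>2)"
    using assms by (auto simp: sos_def)
  then show ?thesis unfolding sos_def by (intro exI[of _ "ps @ qs"]) auto
qed

lemma sos_mult_square:
  assumes "sos n r g" "polyfun n D p" shows "sos n (r + 2 * D) (\<lambda>x. (p x)\<^sup>2 * g x)"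
proof -
  obtain qs where qs: "\<forall>q\<in>set qs. polyfun n (r div 2) q" "\<forall>x. g x = (\<Sum>q\<leftarrow>qs. (q x)\<^sup>2)"
    using assms by (auto simp: sos_def)
  have "polyfun n ((r + 2 * D) div 2) (\<lambda>x. p x * q x)" if "q \<in> set qs" for q
    using polyfun_mult[OF assms(2), of "r div 2" q] qs that by (simp add: add.commute)
  moreover have "(p x)\<^sup>2 * g x = (\<Sum>q\<leftarrow>map (\<lambda>q x. p x * q x) qs. (q x)\<^sup>2)" for x
    using qs by (simp add: sum_list_const_mult[symmetric] power_mult_distrib o_def)
  ultimately show ?thesis
    unfolding sos_def by (intro exI[of _ "map (\<lambda>q x. p x * q x) qs"]) auto
qed

lemma sos_cmult:
  assumes "sos n r g" "0 \<le> c" shows "sos n r (\<lambda>x. c * g x)"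
  using sos_mult_square[OF assms(1) polyfun_const[of n 0 "sqrt c"]] assms(2) by simp

lemma sos_square: "polyfun n D p \<Longrightarrow> sos n (2 * D) (\<lambda>x. (p x)\<^sup>2)"
  unfolding sos_def by (intro exI[of _ "[p]"]) simp

lemma sos_mono: "sos n r g \<Longrightarrow> r \<le> r' \<Longrightarrow> sos n r' g"
  unfolding sos_def by (meson div_le_mono polyfun_mono)

lemma sos_zero: "sos n r (\<lambda>x. 0)"
  unfolding sos_def by (intro exI[of _ "[]"]) simp

lemma qmod_add:
  assumes "qmod n r f" "qmod n r g" shows "qmod n r (\<lambda>x. f x + g x)"
proof -
  obtain s0 s t0 t where "sos n r s0" "\<forall>i<n. sos n (r - 2) (s i)"
      "\<forall>x. f x = s0 x + (\<Sum>i<n. (1 - (x i)\<^sup>2) * s i x)"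
      "sos n r t0" "\<forall>i<n. sos n (r - 2) (t i)"
      "\<forall>x. g x = t0 x + (\<Sum>i<n. (1 - (x i)\<^sup>2) * t i x)"
    using assms by (auto simp: qmod_def)
  then show ?thesis unfolding qmod_def
    by (intro exI[of _ "\<lambda>x. s0 x + t0 x"] exI[of _ "\<lambda>i x. s i x + t i x"])
      (auto simp: sum.distrib distrib_left intro: sos_add)
qed

lemma qmod_mult_square:
  assumes "qmod n r g" "polyfun n D p" "2 \<le> r \<or> D = 0" shows "qmod n (r + 2 * D) (\<lambda>x. (p x)\<^sup>2 * g x)"
proof -
  obtain s0 s where s: "sos n r s0" "\<forall>i<n. sos n (r - 2) (s i)"
      "\<forall>x. g x = s0 x + (\<Sum>i<n. (1 - (x i)\<^sup>2) * s i x)"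
    using assms by (auto simp: qmod_def)
  \<comment> \<open>Subtraction is truncated: for \<open>r < 2\<close> and \<open>D > 0\<close> this
    equality fails, whence the third assumption.\<close>
  have "r + 2 * D - 2 = (r - 2) + 2 * D" using assms(3) by auto
  then have "sos n (r + 2 * D - 2) (\<lambda>x. (p x)\<^sup>2 * s i x)" if "i < n" for i
    using that s sos_mult_square[OF _ assms(2)] by metis
  moreover have "sos n (r + 2 * D) (\<lambda>x. (p x)\<^sup>2 * s0 x)"
    using s assms(2) by (intro sos_mult_square)
  moreover have "(p x)\<^sup>2 * g x = (p x)\<^sup>2 * s0 x + (\<Sum>i<n. (1 - (x i)\<^sup>2) * ((p x)\<^sup>2 * s i x))" for x
    using s by (simp add: distrib_left sum_distrib_left mult_ac)
  ultimately show ?thesis unfolding qmod_def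
    by (intro exI[of _ "\<lambda>x. (p x)\<^sup>2 * s0 x"] exI[of _ "\<lambda>i x. (p x)\<^sup>2 * s i x"]) blast
qed

lemma qmod_cmult:
  assumes "qmod n r g" "0 \<le> c" shows "qmod n r (\<lambda>x. c * g x)"
  using qmod_mult_square[OF assms(1) polyfun_const[of n 0 "sqrt c"]] assms(2) by simp

lemma qmod_sos: "sos n r g \<Longrightarrow> qmod n r g"
  unfolding qmod_def by (intro exI[of _ g] exI[of _ "\<lambda>i x. 0"]) (simp add: sos_zero)

lemma qmod_const: "0 \<le> c \<Longrightarrow> qmod n r (\<lambda>x. c)"
  using sos_mono[OF sos_square[OF polyfun_const[of n 0 "sqrt c"]], of r] by (simp add: qmod_sos)

lemma qmod_sum:
  assumes "\<And>i. i \<in> I \<Longrightarrow> qmod n r (f i)" shows "qmod n r (\<lambda>x. \<Sum>i\<in>I. f i x)"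
  using assms by (induction I rule: infinite_finite_induct)
    (auto intro: qmod_const qmod_add)

lemma qmod_mono:
  assumes "qmod n r g" "r \<le> r'" shows "qmod n r' g"
proof -
  obtain s0 s where "sos n r s0" "\<forall>i<n. sos n (r - 2) (s i)"
      "\<forall>x. g x = s0 x + (\<Sum>i<n. (1 - (x i)\<^sup>2) * s i x)"
    using assms by (auto simp: qmod_def)
  then show ?thesis using sos_mono[OF _ diff_le_mono[OF assms(2), of 2]] assms(2) unfolding qmod_def
    by (intro exI[of _ s0] exI[of _ s]) (auto intro: sos_mono)
qed

subsection \<open>Certified bounds\<close>

text \<open>Certifying \<open>B\<^sup>2 - p\<^sup>2\<close> instead of \<open>B - p\<close> and \<open>B + p\<close> is what makes the
  notion stable under products, since a quadratic module is not.\<close>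
definition qbound :: "nat \<Rightarrow> nat \<Rightarrow> real \<Rightarrow> ((nat \<Rightarrow> real) \<Rightarrow> real) \<Rightarrow> bool" where
  "qbound n D B p \<longleftrightarrow> polyfun n D p \<and> 0 < B \<and> qmod n (2 * D) (\<lambda>x. B\<^sup>2 - (p x)\<^sup>2)"

text \<open>2 B (B - p) = (B^2 - p^2) + (B - p)^2, so the linear bound follows at the same
  degree.\<close>

lemma qbound_imp_qmod:
  assumes "qbound n D B p" shows "qmod n (2 * D) (\<lambda>x. B - p x)"
proof -
  have B: "0 < B" and p: "polyfun n D p" using assms by (auto simp: qbound_def)
  have "qmod n (2 * D) (\<lambda>x. 1 / (2 * B) * ((B\<^sup>2 - (p x)\<^sup>2) + (B - p x)\<^sup>2))"
    using assms by (intro qmod_cmult qmod_add qmod_sos[OF sos_square] polyfun_diff polyfun_const p)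
      (auto simp: qbound_def)
  moreover have "1 / (2 * B) * ((B\<^sup>2 - (p x)\<^sup>2) + (B - p x)\<^sup>2) = B - p x" for x
    using B by (simp add: field_simps power2_eq_square)
  ultimately show ?thesis by simp
qed

lemma qbound_mono:
  assumes "qbound n D B p" "D \<le> D'" "B \<le> B'" shows "qbound n D' B' p"
proof -
  have "B\<^sup>2 \<le> B'\<^sup>2" using assms by (auto simp: qbound_def intro: power_mono)
  then have "qmod n (2 * D') (\<lambda>x. (B'\<^sup>2 - B\<^sup>2) + (B\<^sup>2 - (p x)\<^sup>2))"
    using assms by (intro qmod_add qmod_const) (auto simp: qbound_def elim: qmod_mono)
  then show ?thesis using assms by (auto simp: qbound_def elim: polyfun_mono)
qed

lemma qbound_add:
  assumes "qbound n D B p" "qbound n D C q" shows "qbound n D (B + C) (\<lambda>x. p x + q x)"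
proof -
  have B: "0 < B" "0 < C" and p: "polyfun n D p" "polyfun n D q" using assms by (auto simp: qbound_def)
  \<comment> \<open>Weighted Cauchy-Schwarz, (p + q)^2 <= (B + C) (p^2 / B + q^2 / C), whose defect
    is the square in the last summand.\<close>
  have "qmod n (2 * D) (\<lambda>x. (B + C) / B * (B\<^sup>2 - (p x)\<^sup>2) + (B + C) / C * (C\<^sup>2 - (q x)\<^sup>2)
      + 1 / (B * C) * (C * p x - B * q x)\<^sup>2)"
    using assms by (intro qmod_cmult qmod_add qmod_sos[OF sos_square] polyfun_diff polyfun_cmult p)
      (auto simp: qbound_def)
  moreover have "(B + C) / B * (B\<^sup>2 - (p x)\<^sup>2) + (B + C) / C * (C\<^sup>2 - (q x)\<^sup>2)
      + 1 / (B * C) * (C * p x - B * q x)\<^sup>2 = (B + C)\<^sup>2 - (p x + q x)\<^sup>2" for x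
    using B by (simp add: field_simps power2_eq_square)
  ultimately show ?thesis using p B by (simp add: qbound_def polyfun_add)
qed

lemma qbound_cmult:
  assumes "qbound n D B p" "\<bar>a\<bar> \<le> A" "0 < A" shows "qbound n D (A * B) (\<lambda>x. a * p x)"
proof -
  have "a\<^sup>2 \<le> A\<^sup>2" using assms by (metis abs_le_square_iff abs_of_pos)
  then have "qmod n (2 * D) (\<lambda>x. a\<^sup>2 * (B\<^sup>2 - (p x)\<^sup>2) + (A\<^sup>2 - a\<^sup>2) * B\<^sup>2)"
    using assms by (intro qmod_add qmod_cmult qmod_const) (auto simp: qbound_def)
  then show ?thesis using assms
    by (simp add: qbound_def polyfun_cmult power_mult_distrib algebra_simps)
qed

lemma qbound_sum:
  assumes "finite I" "I \<noteq> {}" "\<And>i. i \<in> I \<Longrightarrow> qbound n D (B i) (p i)"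
  shows "qbound n D (\<Sum>i\<in>I. B i) (\<lambda>x. \<Sum>i\<in>I. p i x)"
  using assms by (induction I rule: finite_ne_induct) (auto intro: qbound_add)

text \<open>(B C)^2 - (p q)^2 = C^2 (B^2 - p^2) + p^2 (C^2 - q^2): a module element is only ever
  multiplied by a square. \<open>1 \<le> E\<close> meets the degree condition of
  \<open>qmod_mult_square\<close>.\<close>

lemma qbound_mult:
  assumes p: "qbound n D B p" and q: "qbound n E C q" and E: "1 \<le> E"
  shows "qbound n (D + E) (B * C) (\<lambda>x. p x * q x)"
proof -
  have "qmod n (2 * E + 2 * D) (\<lambda>x. C\<^sup>2 * (B\<^sup>2 - (p x)\<^sup>2) + (p x)\<^sup>2 * (C\<^sup>2 - (q x)\<^sup>2))"
    using p q E by (intro qmod_add qmod_mult_square qmod_cmult) (auto simp: qbound_def elim: qmod_mono)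
  moreover have "C\<^sup>2 * (B\<^sup>2 - (p x)\<^sup>2) + (p x)\<^sup>2 * (C\<^sup>2 - (q x)\<^sup>2) = (B * C)\<^sup>2 - (p x * q x)\<^sup>2" for x
    by (simp add: power_mult_distrib algebra_simps)
  ultimately show ?thesis using p q
    by (simp add: qbound_def polyfun_mult add.commute)
qed

text \<open>By the Pell identity 1 - T_k(x/L)^2 = (1 - x^2/L^2) U^2, which splits into (1 - 1/L^2)
  U^2 and (1 - x^2) U^2 / L^2. Since U has degree k - 1, the second term respects the truncation of
  the weight.\<close>

lemma qbound_cheb:
  assumes i: "i < n" and L: "1 \<le> L" and k: "k \<le> D"
  shows "qbound n D 1 (\<lambda>x. cheb k (x i / L))"
proof -
  define u where "u = (\<lambda>x::nat \<Rightarrow> real. chebU k (x i / L))"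
  have T: "polyfun n k (\<lambda>x. cheb k (x i / L))" and U: "polyfun n (k - 1) u"
    using polyfun_cheb[OF i, of k L] by (auto simp: u_def)
  have "1 / L\<^sup>2 \<le> 1" using L by simp
  then have "sos n (2 * D) (\<lambda>x. (1 - 1 / L\<^sup>2) * (u x)\<^sup>2)"
    using k by (intro sos_cmult sos_square polyfun_mono[OF U]) auto
  moreover have "sos n (2 * (D - 1)) (\<lambda>x. 1 / L\<^sup>2 * (u x)\<^sup>2)"
    using k by (intro sos_cmult sos_square polyfun_mono[OF U]) auto
  then have "\<forall>j<n. sos n (2 * D - 2) (if j = i then \<lambda>x. 1 / L\<^sup>2 * (u x)\<^sup>2 else (\<lambda>x. 0))"
    by (auto simp: sos_zero right_diff_distrib')
  moreover have "1\<^sup>2 - (cheb k (x i / L))\<^sup>2 = (1 - 1 / L\<^sup>2) * (u x)\<^sup>2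
      + (\<Sum>j<n. (1 - (x j)\<^sup>2) * (if j = i then \<lambda>x. 1 / L\<^sup>2 * (u x)\<^sup>2 else (\<lambda>x. 0)) x)" for x
  proof -
    have "(\<Sum>j<n. (1 - (x j)\<^sup>2) * (if j = i then \<lambda>x. 1 / L\<^sup>2 * (u x)\<^sup>2 else (\<lambda>x. 0)) x)
       = (\<Sum>j<n. if j = i then (1 - (x i)\<^sup>2) * (1 / L\<^sup>2 * (u x)\<^sup>2) else 0)"
      by (intro sum.cong) auto
    also have "\<dots> = (1 - (x i)\<^sup>2) * (1 / L\<^sup>2 * (u x)\<^sup>2)" using i by simp
    finally have "(1 - 1 / L\<^sup>2) * (u x)\<^sup>2
      + (\<Sum>j<n. (1 - (x j)\<^sup>2) * (if j = i then \<lambda>x. 1 / L\<^sup>2 * (u x)\<^sup>2 else (\<lambda>x. 0)) x)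
      = (1 - 1 / L\<^sup>2) * (u x)\<^sup>2 + (1 - (x i)\<^sup>2) * (1 / L\<^sup>2 * (u x)\<^sup>2)" by simp
    also have "\<dots> = (1 - (x i / L)\<^sup>2) * (u x)\<^sup>2"
      using L by (simp add: field_simps power2_eq_square)
    also have "\<dots> = 1\<^sup>2 - (cheb k (x i / L))\<^sup>2"
      using cheb_Pell[of k "x i / L"] by (simp add: u_def algebra_simps)
    finally show ?thesis by simp
  qed
  ultimately have "qmod n (2 * D) (\<lambda>x. 1\<^sup>2 - (cheb k (x i / L))\<^sup>2)"
    unfolding qmod_def
    by (intro exI[of _ "\<lambda>x. (1 - 1 / L\<^sup>2) * (u x)\<^sup>2"]
          exI[of _ "\<lambda>j. if j = i then \<lambda>x. 1 / L\<^sup>2 * (u x)\<^sup>2 else (\<lambda>x. 0)"]) blast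
  with polyfun_mono[OF T k] show ?thesis by (simp add: qbound_def)
qed

text \<open>Turns a sup-norm bound into a certificate by bounding each Chebyshev coefficient. The
  loss of a factor 2 (D + 1) is affordable because it is applied to the tiny cross term of the
  kernel.\<close>

lemma qbound_cheb_span:
  assumes i: "i < n" and g: "cheb_span D g" and B: "\<And>z. \<bar>z\<bar> \<le> 1 \<Longrightarrow> \<bar>g z\<bar> \<le> B" and B0: "0 < B"
  shows "qbound n D (2 * (real D + 1) * B) (\<lambda>x. g (x i))"
proof -
  obtain a where a: "\<And>z. g z = (\<Sum>m\<le>D. a m * cheb m z)" using g by (auto simp: cheb_span_def)
  have "qbound n D (2 * B * 1) (\<lambda>x. a m * cheb m (x i / 1))" if "m \<in> {..D}" for m
    using cheb_coeff_le[OF a B, of m] that B0 by (intro qbound_cmult qbound_cheb i) auto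
  then have "qbound n D (\<Sum>m\<le>D. 2 * B * 1) (\<lambda>x. \<Sum>m\<le>D. a m * cheb m (x i / 1))"
    by (intro qbound_sum) auto
  then show ?thesis by (simp add: a algebra_simps)
qed

lemma qbound_prod:
  assumes P: "\<And>i. i < m \<Longrightarrow> qbound n D B (P i)" and D: "1 \<le> D" and m: "1 \<le> m"
  shows "qbound n (m * D) (B ^ m) (\<lambda>x. \<Prod>i<m. P i x)"
  using m P
proof (induction m rule: nat_induct_at_least)
  case (Suc m)
  then have "qbound n (m * D + D) (B ^ m * B) (\<lambda>x. (\<Prod>i<m. P i x) * P m x)"
    by (intro qbound_mult D) auto
  then show ?case by (simp add: add.commute mult.commute)
qed simp

text \<open>The difference of the products telescopes over the coordinates.\<close>
lemma qbound_prod_diff: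
  assumes T: "\<And>i. i < m \<Longrightarrow> qbound n D 1 (T i)" and D: "1 \<le> D" and \<eta>: "0 < \<eta>"
    and TP: "\<And>i. i < m \<Longrightarrow> qbound n D \<eta> (\<lambda>x. T i x - P i x)" and m: "1 \<le> m"
  shows "qbound n (m * D) (real m * \<eta> * (1 + \<eta>) ^ m) (\<lambda>x. (\<Prod>i<m. T i x) - (\<Prod>i<m. P i x))"
  using m T TP
proof (induction m rule: nat_induct_at_least)
  case base
  moreover have "\<eta> \<le> \<eta> * (1 + \<eta>)" using \<eta> by simp
  ultimately show ?case by (auto intro: qbound_mono)
next
  case (Suc m)
  have P: "qbound n D (1 + \<eta>) (P i)" if "i < m" for i
  proof -
    have "qbound n D (1 + 1 * \<eta>) (\<lambda>x. T i x + (- 1) * (T i x - P i x))"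
      using Suc.prems that by (intro qbound_add qbound_cmult) auto
    then show ?thesis by simp
  qed
  have IH: "qbound n (m * D) ((1 + \<eta>) ^ m) (\<lambda>x. \<Prod>i<m. P i x)"
    "qbound n (m * D) (real m * \<eta> * (1 + \<eta>) ^ m) (\<lambda>x. (\<Prod>i<m. T i x) - (\<Prod>i<m. P i x))"
    using Suc qbound_prod[OF P D] by auto
  have "qbound n (m * D + D) (real m * \<eta> * (1 + \<eta>) ^ m * 1 + (1 + \<eta>) ^ m * \<eta>)
     (\<lambda>x. ((\<Prod>i<m. T i x) - (\<Prod>i<m. P i x)) * T m x + (\<Prod>i<m. P i x) * (T m x - P m x))"
    using Suc.prems by (intro qbound_add qbound_mult D IH) auto
  then have *: "qbound n (Suc m * D) (real (Suc m) * \<eta> * (1 + \<eta>) ^ m)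
     (\<lambda>x. (\<Prod>i<Suc m. T i x) - (\<Prod>i<Suc m. P i x))"
    by (simp add: algebra_simps)
  have "(1 + \<eta>) ^ m \<le> (1 + \<eta>) ^ Suc m" using \<eta> by (intro power_increasing) auto
  then have "real (Suc m) * \<eta> * (1 + \<eta>) ^ m \<le> real (Suc m) * \<eta> * (1 + \<eta>) ^ Suc m"
    using \<eta> by (intro mult_left_mono) auto
  with * show ?case by (auto intro: qbound_mono)
qed

subsection \<open>A sum-of-squares kernel from the Dolph--Chebyshev window\<close>

text \<open>The affine map in \<open>window\<close> takes [-1, 1] onto [-1, 1 + h], so the window
  peaks with value T_M(1 + h). The bound on \<open>N\<close> makes averages exact for the squared
  window (degree 2 M) against cosines of frequency up to 2 M.\<close>

locale cheb_kernel =
  fixes M N :: nat and h :: real and a :: "nat \<Rightarrow> real"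
  assumes M: "1 \<le> M" and N: "4 * M + 1 < N" and h: "0 < h" "h \<le> 1"
    and window: "\<And>z. cheb M (h / 2 + (1 + h / 2) * z) = (\<Sum>m\<le>M. a m * cheb m z)"
begin

definition A :: "real \<Rightarrow> real" where
  "A u = cheb M (h / 2 + (1 + h / 2) * cos u)"

text \<open>\<open>A\<close> is bounded by \<open>1\<close> where \<open>cos u \<le> 1 / L\<close>; rescaling the
  kernel to \<open>[- L, L]\<close> keeps \<open>[- 1, 1]\<close> away from the endpoints.\<close>
definition L :: real where
  "L = (1 + h / 2) / (1 - h / 2)"

definition lam :: "nat \<Rightarrow> real" where
  "lam j = avg N (\<lambda>u. cos (real j * u) * (A u)\<^sup>2)"

text \<open>For x = L cos(theta) this is the even part in theta of A(u - theta), see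
  \<open>H_cos\<close>; in the present form it is visibly a polynomial in x.\<close>

definition H :: "real \<Rightarrow> real \<Rightarrow> real" where
  "H u x = (\<Sum>m\<le>M. a m * cos (real m * u) * cheb m (1 / L * x))"

text \<open>The two shifted squares inside \<open>H\<close> contribute \<open>lam 0 / 2\<close> to
  its mean square; with the factor 2 the weights sum to 1 up to the cross term.\<close>

definition wt :: "nat \<Rightarrow> real \<Rightarrow> real" where
  "wt i x = 2 / (real N * lam 0) * (H (node N i) x)\<^sup>2"

definition R :: "nat \<Rightarrow> real \<Rightarrow> real" where
  "R j x = (\<Sum>i<N. cos (real j * node N i) * wt i x)"

definition C :: "nat \<Rightarrow> real \<Rightarrow> real" where
  "C j x = R j x - lam j / lam 0 * cheb j (1 / L * x)"

lemma N_pos: "0 < N" using N by simp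

lemma L_gt_1: "1 < L" using h by (simp add: L_def field_simps)

lemma A_sum: "A u = (\<Sum>m\<le>M. a m * cos (real m * u))"
  by (simp add: A_def window cheb_cos)

lemma A_le_1:
  assumes "cos u \<le> 1 / L" shows "\<bar>A u\<bar> \<le> 1"
proof -
  have "(1 + h / 2) * cos u \<le> (1 + h / 2) * (1 / L)" "(1 + h / 2) * (- 1) \<le> (1 + h / 2) * cos u"
    by (intro mult_left_mono; use assms h in simp)+
  moreover have "(1 + h / 2) * (1 / L) = 1 - h / 2" using h by (simp add: L_def field_simps)
  ultimately show ?thesis unfolding A_def by (intro abs_cheb_le_1) (auto simp: abs_le_iff)
qed

lemma A_square_expansion:
  obtains e where "\<And>u. (A u)\<^sup>2 = (\<Sum>m\<le>2 * M. e m * cos (real m * u))"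
proof -
  have "cheb_span (M + M) (\<lambda>z. cheb M (h / 2 + (1 + h / 2) * z) * cheb M (h / 2 + (1 + h / 2) * z))"
    by (intro cheb_span_mult cheb_span_affine)
  then obtain e where "\<And>z. cheb M (h / 2 + (1 + h / 2) * z) * cheb M (h / 2 + (1 + h / 2) * z)
      = (\<Sum>m\<le>M + M. e m * cheb m z)" by (auto simp: cheb_span_def)
  then have "(A u)\<^sup>2 = (\<Sum>m\<le>2 * M. e m * cos (real m * u))" for u
    unfolding A_def power2_eq_square by (simp add: cheb_cos mult_2)
  then show ?thesis by (rule that)
qed

text \<open>\<open>\<theta>\<close> need not be a multiple of the node spacing, so shift invariance
  of the discrete mean is not automatic; it comes from exactness on all frequencies that
  occur.\<close>

lemma avg_A_square_shift:
  assumes "j \<le> 2 * M"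
  shows "avg N (\<lambda>u. cos (real j * u) * (A (u - \<theta>))\<^sup>2) = cos (real j * \<theta>) * lam j"
proof -
  obtain e where e: "\<And>u. (A u)\<^sup>2 = (\<Sum>m\<le>2 * M. e m * cos (real m * u))"
    by (rule A_square_expansion) blast
  have *: "avg N (\<lambda>u. cos (real j * u) * (A (u - \<theta>))\<^sup>2)
    = cos (real j * \<theta>) * (\<Sum>m\<le>2 * M. e m * (if j = m then if j = 0 then 1 else 1 / 2 else 0))" for \<theta>
  proof -
    have "avg N (\<lambda>u. cos (real j * u) * (A (u - \<theta>))\<^sup>2)
      = avg N (\<lambda>u. \<Sum>m\<le>2 * M. e m * (cos (real j * u) * cos (real m * (u - \<theta>))))"
      by (simp add: e sum_distrib_left mult_ac)
    also have "\<dots> = (\<Sum>m\<le>2 * M. e m * (cos (real j * \<theta>) * (if j = m then if j = 0 then 1 else 1 / 2 else 0)))"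
      unfolding avg_sum avg_cmult using assms N by (intro sum.cong) (auto simp: avg_cos_cos_shift)
    finally show ?thesis by (simp add: sum_distrib_left mult_ac)
  qed
  show ?thesis unfolding *[of \<theta>] lam_def using *[of 0] by simp
qed

lemma lam_0: "lam 0 = avg N (\<lambda>u. (A u)\<^sup>2)" by (simp add: lam_def)

text \<open>The peak is at most the sum of the M + 1 coefficients in modulus, each at most twice the
  mean of |A|, hence twice its root mean square. This turns the size of T_M(1 + h) into a lower
  bound on \<open>lam 0\<close>.\<close>

lemma cheb_peak_le: "cheb M (1 + h) \<le> 2 * (real M + 1) * sqrt (lam 0)"
proof -
  have "cheb M (1 + h) = A 0" by (simp add: A_def add.commute)
  also have "\<dots> \<le> (\<Sum>m\<le>M. \<bar>a m\<bar>)" unfolding A_sum by (intro sum_mono) simp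
  also have "\<dots> \<le> (\<Sum>m\<le>M. 2 * sqrt (lam 0))"
  proof (rule sum_mono)
    fix m assume "m \<in> {..M}"
    then have "\<bar>a m\<bar> \<le> 2 * avg N (\<lambda>u. \<bar>A u\<bar>)"
      using cheb_coeff_avg[OF window, of N m] N by (simp add: A_def)
    also have "\<dots> \<le> 2 * sqrt (lam 0)" unfolding lam_0 using avg_abs_le_sqrt[OF N_pos] by simp
    finally show "\<bar>a m\<bar> \<le> 2 * sqrt (lam 0)" .
  qed
  finally show ?thesis by (simp add: algebra_simps)
qed

lemma lam_0_pos: "0 < lam 0"
proof -
  have "0 < 2 * (real M + 1) * sqrt (lam 0)"
    using cheb_peak_le cheb_ge_1[of "1 + h" M] h by linarith
  then show ?thesis by (simp add: zero_less_mult_iff)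
qed

section \<open>The kernel operator as a Fourier multiplier plus a cross term\<close>

lemma H_cos: "H u (L * cos \<theta>) = (A (u - \<theta>) + A (u + \<theta>)) / 2"
proof -
  have "a m * cos (real m * u) * cheb m (1 / L * (L * cos \<theta>))
     = (a m * cos (real m * (u - \<theta>)) + a m * cos (real m * (u + \<theta>))) / 2" for m
  proof -
    have "2 * (cos (real m * u) * cos (real m * \<theta>)) = cos (real m * (u - \<theta>)) + cos (real m * (u + \<theta>))"
      by (simp add: right_diff_distrib distrib_left cos_add cos_diff)
    then show ?thesis using L_gt_1 by (simp add: cheb_cos flip: distrib_left)
  qed
  then have "H u (L * cos \<theta>) = (\<Sum>m\<le>M. (a m * cos (real m * (u - \<theta>)) + a m * cos (real m * (u + \<theta>))) / 2)"
    unfolding H_def by (intro sum.cong) auto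
  then show ?thesis unfolding A_sum by (simp only: sum.distrib[symmetric] sum_divide_distrib[symmetric])
qed

lemma R_avg: "R j x = 2 / lam 0 * avg N (\<lambda>u. cos (real j * u) * (H u x)\<^sup>2)"
  using N_pos by (simp add: R_def avg_def wt_def sum_distrib_left sum_divide_distrib mult_ac)

text \<open>Squaring \<open>H_cos\<close> gives two shifted squares and a product. The squares
  produce exactly the multiplier \<open>lam j / lam 0\<close>; the product is what remains in
  \<open>C\<close>.\<close>

lemma C_cos:
  assumes "j \<le> 2 * M"
  shows "C j (L * cos \<theta>) = avg N (\<lambda>u. cos (real j * u) * (A (u - \<theta>) * A (u + \<theta>))) / lam 0"
proof -
  have "cos (real j * u) * (H u (L * cos \<theta>))\<^sup>2
     = 1 / 4 * (cos (real j * u) * (A (u - \<theta>))\<^sup>2) + 1 / 4 * (cos (real j * u) * (A (u - - \<theta>))\<^sup>2)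
       + 1 / 2 * (cos (real j * u) * (A (u - \<theta>) * A (u + \<theta>)))" for u
    unfolding H_cos by (simp add: power2_eq_square field_simps)
  then have "R j (L * cos \<theta>) = 2 / lam 0 * (1 / 2 * (cos (real j * \<theta>) * lam j)
      + 1 / 2 * avg N (\<lambda>u. cos (real j * u) * (A (u - \<theta>) * A (u + \<theta>))))"
    unfolding R_avg
    by (simp only: avg_add avg_cmult avg_A_square_shift[OF assms]) (simp add: field_simps)
  then show ?thesis
    using L_gt_1 lam_0_pos by (simp add: C_def cheb_cos field_simps)
qed

lemma cheb_span_H: "cheb_span M (H u)"
proof -
  have "cheb_span M (\<lambda>x. \<Sum>m\<le>M. a m * cos (real m * u) * cheb m (0 + 1 / L * x))"
    by (intro cheb_span_sum cheb_span_cmult cheb_span_mono[OF cheb_span_affine]) auto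
  then show ?thesis by (simp add: H_def[abs_def])
qed

lemma cheb_span_C:
  assumes "j \<le> 2 * M" shows "cheb_span (2 * M) (C j)"
proof -
  have "cheb_span (M + M) (\<lambda>x. H u x * H u x)" for u by (intro cheb_span_mult cheb_span_H)
  then have "cheb_span (2 * M) (\<lambda>x. (H u x)\<^sup>2)" for u by (simp add: power2_eq_square mult_2)
  moreover have "cheb_span (2 * M) (\<lambda>x. cheb j (0 + 1 / L * x))"
    using assms by (rule cheb_span_mono[OF cheb_span_affine])
  ultimately show ?thesis unfolding C_def[abs_def] R_def wt_def
    by (intro cheb_span_diff cheb_span_sum cheb_span_cmult) auto
qed

text \<open>With cos(theta) = x / L, the sum of cos(u - theta) and cos(u + theta) is at most 2 / L,
  so one of the two factors A is at most 1 in modulus. The product is then at most the sum of the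
  moduli, whose mean is at most 2 sqrt(\<open>lam 0\<close>).\<close>

lemma abs_C_le:
  assumes j: "j \<le> 2 * M" and x: "\<bar>x\<bar> \<le> 1" shows "\<bar>C j x\<bar> \<le> 2 / sqrt (lam 0)"
proof -
  define \<theta> where "\<theta> = arccos (x / L)"
  have xL: "\<bar>x / L\<bar> \<le> 1 / L" using x L_gt_1 by (simp add: divide_right_mono)
  moreover have "1 / L \<le> 1" using L_gt_1 by simp
  ultimately have "\<bar>x / L\<bar> \<le> 1" by (rule order_trans)
  then have c: "cos \<theta> = x / L" unfolding \<theta>_def abs_le_iff by (intro cos_arccos) linarith+
  have A1: "\<bar>A (u - \<theta>)\<bar> \<le> 1 \<or> \<bar>A (u + \<theta>)\<bar> \<le> 1" for u
  proof -
    have "cos (u - \<theta>) + cos (u + \<theta>) = 2 * (cos u * cos \<theta>)" by (simp add: cos_add cos_diff)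
    moreover have "cos u * cos \<theta> \<le> 1 / L"
    proof -
      have "\<bar>cos u * cos \<theta>\<bar> \<le> 1 * (1 / L)"
        unfolding abs_mult c using xL by (intro mult_mono) auto
      then show ?thesis by simp
    qed
    ultimately have "cos (u - \<theta>) \<le> 1 / L \<or> cos (u + \<theta>) \<le> 1 / L" by linarith
    then show ?thesis using A_le_1 by blast
  qed
  have "\<bar>cos (real j * u) * (A (u - \<theta>) * A (u + \<theta>))\<bar> \<le> \<bar>A (u - \<theta>)\<bar> + \<bar>A (u + \<theta>)\<bar>" for u
  proof -
    have "\<bar>cos (real j * u) * (A (u - \<theta>) * A (u + \<theta>))\<bar> \<le> 1 * (\<bar>A (u - \<theta>)\<bar> * \<bar>A (u + \<theta>)\<bar>)"
      unfolding abs_mult by (intro mult_right_mono) auto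
    also have "\<dots> \<le> \<bar>A (u - \<theta>)\<bar> + \<bar>A (u + \<theta>)\<bar>"
      using A1[of u] mult_right_mono[of "\<bar>A (u - \<theta>)\<bar>" 1 "\<bar>A (u + \<theta>)\<bar>"]
        mult_left_mono[of "\<bar>A (u + \<theta>)\<bar>" 1 "\<bar>A (u - \<theta>)\<bar>"] by linarith
    finally show ?thesis .
  qed
  then have "\<bar>avg N (\<lambda>u. cos (real j * u) * (A (u - \<theta>) * A (u + \<theta>)))\<bar>
      \<le> avg N (\<lambda>u. \<bar>A (u - \<theta>)\<bar> + \<bar>A (u + \<theta>)\<bar>)"
    by (intro order_trans[OF abs_avg_le] avg_mono)
  also have "\<dots> = avg N (\<lambda>u. \<bar>A (u - \<theta>)\<bar>) + avg N (\<lambda>u. \<bar>A (u + \<theta>)\<bar>)" by (rule avg_add)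
  also have "\<dots> \<le> sqrt (avg N (\<lambda>u. (A (u - \<theta>))\<^sup>2)) + sqrt (avg N (\<lambda>u. (A (u + \<theta>))\<^sup>2))"
    by (intro add_mono avg_abs_le_sqrt N_pos)
  also have "\<dots> = 2 * sqrt (lam 0)"
    using avg_A_square_shift[of 0 \<theta>] avg_A_square_shift[of 0 "- \<theta>"] by simp
  finally have "\<bar>C j (L * cos \<theta>)\<bar> \<le> 2 * sqrt (lam 0) / lam 0"
    unfolding C_cos[OF j] using lam_0_pos by (simp add: divide_right_mono)
  also have "2 * sqrt (lam 0) / lam 0 = 2 / sqrt (lam 0)"
    using lam_0_pos by (simp add: field_simps)
  finally show ?thesis using c L_gt_1 by simp
qed

text \<open>Integration by parts: the derivative of \<open>sin u * (A u)\<^sup>2\<close> has mean zero.\<close>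
lemma avg_by_parts:
  "avg N (\<lambda>u. cos u * (A u)\<^sup>2)
    = 2 * (1 + h / 2) * M * avg N (\<lambda>u. (sin u)\<^sup>2 * (A u * chebU M (h / 2 + (1 + h / 2) * cos u)))"
proof -
  obtain e where e: "\<And>u. (A u)\<^sup>2 = (\<Sum>m\<le>2 * M. e m * cos (real m * u))"
    by (rule A_square_expansion) blast
  let ?b = "1 + h / 2" and ?U = "\<lambda>u. chebU M (h / 2 + (1 + h / 2) * cos u)"
  \<comment> \<open>The derivative of the squared window computed twice, by the chain rule and
    termwise from its cosine expansion.\<close>
  have D: "(\<Sum>m\<le>2 * M. e m * (real m * sin (real m * u))) = 2 * ?b * M * (sin u * (A u * ?U u))" for u
  proof -
    have "((\<lambda>u. (A u)\<^sup>2) has_real_derivative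
        2 * A u * (real M * ?U u * (?b * - sin u))) (at u)"
      unfolding A_def by (auto intro!: derivative_eq_intros DERIV_chain2[OF DERIV_cheb])
    moreover have "((\<lambda>u. (A u)\<^sup>2) has_real_derivative
        (\<Sum>m\<le>2 * M. e m * (- sin (real m * u) * real m))) (at u)"
      unfolding e by (auto intro!: derivative_eq_intros sum.cong)
    ultimately have "2 * A u * (real M * ?U u * (?b * - sin u))
      = (\<Sum>m\<le>2 * M. e m * (- sin (real m * u) * real m))" by (rule DERIV_unique)
    then have "(\<Sum>m\<le>2 * M. e m * (- sin (real m * u) * real m)) = - (2 * ?b * M * (sin u * (A u * ?U u)))"
      by (simp only: mult_minus_left mult_minus_right mult_ac)
    then show ?thesis by (simp add: sum_negf mult_ac)
  qed
  have cc: "avg N (\<lambda>u. cos u * cos (real m * u)) = (if m = 1 then 1 / 2 else 0)"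
    if "m \<le> 2 * M" for m
    using avg_cos_cos[of 1 m N] N M that by auto
  have ss: "avg N (\<lambda>u. sin u * sin (real m * u)) = (if m = 1 then 1 / 2 else 0)"
    if "m \<le> 2 * M" for m
  proof -
    have "sin u * sin (real m * u) = cos u * cos (real m * u) - cos (of_int (int (Suc m)) * u + 0)" for u
      by (simp add: cos_add ring_distribs)
    moreover have "avg N (\<lambda>u. cos (of_int (int (Suc m)) * u + 0)) = 0"
      using N M that by (subst avg_cos) auto
    ultimately show ?thesis using cc[OF that] by (simp only: avg_diff)
  qed
  have "avg N (\<lambda>u. cos u * (A u)\<^sup>2) = (\<Sum>m\<le>2 * M. e m * avg N (\<lambda>u. cos u * cos (real m * u)))"
    unfolding e avg_cmult[symmetric] avg_sum[symmetric] by (simp add: sum_distrib_left mult_ac)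
  \<comment> \<open>Only m = 1 survives on either side, and there the factor \<open>real m\<close>
    is 1.\<close>
  also have "\<dots> = (\<Sum>m\<le>2 * M. (e m * real m) * avg N (\<lambda>u. sin u * sin (real m * u)))"
    by (intro sum.cong) (auto simp: cc ss)
  also have "\<dots> = avg N (\<lambda>u. sin u * (\<Sum>m\<le>2 * M. e m * (real m * sin (real m * u))))"
    unfolding avg_cmult[symmetric] avg_sum[symmetric] by (simp add: sum_distrib_left mult_ac)
  also have "\<dots> = 2 * ?b * M * avg N (\<lambda>u. (sin u)\<^sup>2 * (A u * ?U u))"
    unfolding D avg_cmult[symmetric] by (simp add: power2_eq_square mult_ac)
  finally show ?thesis .
qed

text \<open>Where cos u >= 0, 1 - cos u is at most sin(u)^2; elsewhere |A| <= 1 and the cost is 2.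
  Then \<open>cheb_power2_le\<close> replaces A^2 by A U, with \<open>\<sigma>\<close> the value of
  sqrt(z^2 - 1) at the peak, and \<open>avg_by_parts\<close> bounds the mean of sin^2 A U by
  \<open>lam 0 / (2 * M)\<close>.\<close>

lemma second_moment_le:
  assumes \<sigma>: "\<sigma>\<^sup>2 = (1 + h)\<^sup>2 - 1" "0 \<le> \<sigma>"
  shows "avg N (\<lambda>u. (1 - cos u) * (A u)\<^sup>2) \<le> \<sigma> / (2 * M) * lam 0 + (3 + \<sigma> * M)"
proof -
  let ?b = "1 + h / 2" and ?z = "\<lambda>u. h / 2 + (1 + h / 2) * cos u"
  have z: "-1 \<le> ?z u \<and> ?z u \<le> 1 + h" for u
  proof -
    have "?b * (-1) \<le> ?b * cos u" "?b * cos u \<le> ?b * 1"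
      using h by (auto simp only: intro!: mult_left_mono) auto
    then show ?thesis by auto
  qed
  have A2: "(A u)\<^sup>2 \<le> 1 + \<sigma> * M + \<sigma> * (A u * chebU M (?z u))" for u
  proof -
    have "(?z u)\<^sup>2 \<le> (1 + h)\<^sup>2"
      using z[of u] h by (intro abs_le_square_iff[THEN iffD1]) auto
    then show ?thesis unfolding A_def using z[of u] \<sigma> by (intro cheb_power2_le) auto
  qed
  have "(1 - cos u) * (A u)\<^sup>2 \<le> (3 + \<sigma> * M) + \<sigma> * ((sin u)\<^sup>2 * (A u * chebU M (?z u)))" for u
  proof -
    have s: "(sin u)\<^sup>2 * (A u)\<^sup>2 \<le> (1 + \<sigma> * M) + \<sigma> * ((sin u)\<^sup>2 * (A u * chebU M (?z u)))"
    proof -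
      have "(sin u)\<^sup>2 * (A u)\<^sup>2 \<le> (sin u)\<^sup>2 * (1 + \<sigma> * M + \<sigma> * (A u * chebU M (?z u)))"
        by (intro mult_left_mono A2) auto
      moreover have "(sin u)\<^sup>2 * (1 + \<sigma> * M) \<le> 1 * (1 + \<sigma> * M)"
        using \<sigma> by (intro mult_right_mono) (auto simp: abs_square_le_1)
      ultimately show ?thesis by (simp add: algebra_simps)
    qed
    have "(1 - cos u) * (A u)\<^sup>2 \<le> (sin u)\<^sup>2 * (A u)\<^sup>2 + 2"
    proof (cases "0 \<le> cos u")
      case True
      have "(1 - cos u) * 1 \<le> (1 - cos u) * (1 + cos u)" using True by (intro mult_left_mono) auto
      also have "\<dots> = (sin u)\<^sup>2" by (simp add: sin_squared_eq power2_eq_square algebra_simps)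
      finally have "(1 - cos u) * (A u)\<^sup>2 \<le> (sin u)\<^sup>2 * (A u)\<^sup>2" by (intro mult_right_mono) auto
      then show ?thesis by simp
    next
      case False
      have "0 \<le> 1 / L" using L_gt_1 by simp
      then have "\<bar>A u\<bar> \<le> 1" using False by (intro A_le_1) linarith
      then have "(1 - cos u) * (A u)\<^sup>2 \<le> 2 * 1"
        using cos_ge_minus_one[of u] by (intro mult_mono) (auto simp: abs_square_le_1)
      moreover have "0 \<le> (sin u)\<^sup>2 * (A u)\<^sup>2" by simp
      ultimately show ?thesis by linarith
    qed
    with s show ?thesis by linarith
  qed
  then have "avg N (\<lambda>u. (1 - cos u) * (A u)\<^sup>2)
      \<le> avg N (\<lambda>u. (3 + \<sigma> * M) + \<sigma> * ((sin u)\<^sup>2 * (A u * chebU M (?z u))))" by (rule avg_mono)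
  also have "\<dots> = (3 + \<sigma> * M) + \<sigma> * avg N (\<lambda>u. (sin u)\<^sup>2 * (A u * chebU M (?z u)))"
    by (simp only: avg_add avg_cmult avg_const[OF N_pos])
  also have "\<dots> \<le> (3 + \<sigma> * M) + \<sigma> * (lam 0 / (2 * M))"
  proof (intro add_left_mono mult_left_mono \<sigma>)
    let ?S = "avg N (\<lambda>u. (sin u)\<^sup>2 * (A u * chebU M (?z u)))"
    have "avg N (\<lambda>u. cos u * (A u)\<^sup>2) \<le> lam 0"
      unfolding lam_0
    proof (rule avg_mono)
      show "cos u * (A u)\<^sup>2 \<le> (A u)\<^sup>2" for u
        using mult_right_mono[OF cos_le_one[of u], of "(A u)\<^sup>2"] by simp
    qed
    then have *: "?b * (2 * M * ?S) \<le> lam 0" unfolding avg_by_parts by (simp only: mult_ac)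
    \<comment> \<open>Dropping the factor 1 + h/2 from \<open>*\<close> depends on the sign of the
      mean.\<close>
    have "2 * M * ?S \<le> lam 0"
    proof (cases "0 \<le> ?S")
      case True
      then have "1 * (2 * M * ?S) \<le> ?b * (2 * M * ?S)" using h by (intro mult_right_mono) auto
      with * show ?thesis by linarith
    next
      case False
      then have "2 * M * ?S \<le> 0" by (simp add: mult_nonneg_nonpos)
      with lam_0_pos show ?thesis by linarith
    qed
    then show "?S \<le> lam 0 / (2 * M)" using M by (simp add: field_simps)
  qed
  finally show ?thesis by (simp add: mult.commute add.commute)
qed

lemma lam_ratio:
  assumes v: "avg N (\<lambda>u. (1 - cos u) * (A u)\<^sup>2) \<le> v * lam 0"
  shows "\<bar>1 - lam j / lam 0\<bar> \<le> v * (real j)\<^sup>2"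
proof -
  have d: "lam 0 - lam j = avg N (\<lambda>u. (1 - cos (real j * u)) * (A u)\<^sup>2)"
    by (simp add: lam_def left_diff_distrib avg_diff)
  have "0 \<le> lam 0 - lam j" unfolding d by (intro avg_nonneg) simp
  moreover have "lam 0 - lam j \<le> avg N (\<lambda>u. (real j)\<^sup>2 * ((1 - cos u) * (A u)\<^sup>2))"
    unfolding d mult.assoc[symmetric] by (intro avg_mono mult_right_mono one_minus_cos_multiple_le) auto
  then have "lam 0 - lam j \<le> (real j)\<^sup>2 * (v * lam 0)"
    unfolding avg_cmult using mult_left_mono[OF v, of "(real j)\<^sup>2"] by simp
  ultimately show ?thesis using lam_0_pos by (simp add: field_simps)
qed

text \<open>T_k(L z) is expanded in the T_j(z), with coefficients at most 2 \<open>\<tau>\<close>.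
  On each T_j(x/L) the operator acts as a multiplier near 1, up to \<open>C j\<close>, so the error
  is a sum of certified pieces.\<close>

lemma qbound_kernel:
  assumes i: "i < n" and k: "k \<le> 2 * M" and \<tau>: "cheb k L \<le> \<tau>"
    and v: "avg N (\<lambda>u. (1 - cos u) * (A u)\<^sup>2) \<le> v * lam 0" "0 < v"
  shows "qbound n (2 * M)
     ((real k + 1) * (2 * \<tau> * (v * ((real k)\<^sup>2 + 1) + 2 * (2 * M + 1) * (2 / sqrt (lam 0)))))
     (\<lambda>x. cheb k (x i) - (\<Sum>l<N. cheb k (L * cos (node N l)) * wt l (x i)))"
proof -
  have \<tau>1: "1 \<le> \<tau>" using cheb_ge_1[of L k] \<tau> L_gt_1 by linarith
  obtain b where b0: "\<And>z. cheb k (0 + L * z) = (\<Sum>j\<le>k. b j * cheb j z)"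
    using cheb_span_affine[of k 0 L] by (auto simp: cheb_span_def)
  then have b: "\<And>z. cheb k (L * z) = (\<Sum>j\<le>k. b j * cheb j z)" by simp
  have b_le: "\<bar>b j\<bar> \<le> 2 * \<tau>" if "j \<le> k" for j
  proof (rule cheb_coeff_le[OF b _ that])
    fix z :: real assume "\<bar>z\<bar> \<le> 1"
    then have "\<bar>L * z\<bar> \<le> L" using L_gt_1 by (simp add: abs_mult)
    then show "\<bar>cheb k (L * z)\<bar> \<le> \<tau>" using abs_cheb_le_cheb[of L "L * z" k] L_gt_1 \<tau> by linarith
  qed
  have eq: "cheb k (x i) - (\<Sum>l<N. cheb k (L * cos (node N l)) * wt l (x i))
     = (\<Sum>j\<le>k. b j * ((1 - lam j / lam 0) * cheb j (x i / L) + (- 1) * C j (x i)))" for x :: "nat \<Rightarrow> real"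
  proof -
    have "cheb k (x i) = (\<Sum>j\<le>k. b j * cheb j (x i / L))" using b[of "x i / L"] L_gt_1 by simp
    moreover have "(\<Sum>l<N. cheb k (L * cos (node N l)) * wt l (x i)) = (\<Sum>j\<le>k. b j * R j (x i))"
    proof -
      have "(\<Sum>l<N. cheb k (L * cos (node N l)) * wt l (x i))
        = (\<Sum>l<N. \<Sum>j\<le>k. b j * (cos (real j * node N l) * wt l (x i)))"
      unfolding b cheb_cos sum_distrib_right by (simp only: mult.assoc)
      also have "\<dots> = (\<Sum>j\<le>k. b j * R j (x i))"
        by (subst sum.swap) (simp add: R_def sum_distrib_left)
      finally show ?thesis .
    qed
    ultimately show ?thesis by (simp add: C_def sum_subtractf[symmetric] algebra_simps)
  qed
  \<comment> \<open>The added 1 keeps the bound positive at \<open>k = 0\<close>, as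
    \<open>qbound_cmult\<close> demands.\<close>
  have k0: "0 < (real k)\<^sup>2 + 1" by (simp add: add_nonneg_pos)
  have "qbound n (2 * M) (2 * \<tau> * (v * ((real k)\<^sup>2 + 1) * 1 + 1 * (2 * (real (2 * M) + 1) * (2 / sqrt (lam 0)))))
      (\<lambda>x. b j * ((1 - lam j / lam 0) * cheb j (x i / L) + (- 1) * C j (x i)))" if "j \<in> {..k}" for j
  proof (intro qbound_cmult qbound_add qbound_cheb qbound_cheb_span cheb_span_C abs_C_le i)
    have "(real j)\<^sup>2 \<le> (real k)\<^sup>2" using that by (intro power_mono) auto
    then have "(real j)\<^sup>2 \<le> (real k)\<^sup>2 + 1" by linarith
    then have "v * (real j)\<^sup>2 \<le> v * ((real k)\<^sup>2 + 1)" using v by (intro mult_left_mono) auto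
    then show "\<bar>1 - lam j / lam 0\<bar> \<le> v * ((real k)\<^sup>2 + 1)" using lam_ratio[OF v(1), of j] by linarith
  qed (use that k k0 b_le \<tau>1 L_gt_1 lam_0_pos v in auto)
  then have "qbound n (2 * M) (\<Sum>j\<le>k. 2 * \<tau> * (v * ((real k)\<^sup>2 + 1) * 1 + 1 * (2 * (real (2 * M) + 1) * (2 / sqrt (lam 0)))))
      (\<lambda>x. \<Sum>j\<le>k. b j * ((1 - lam j / lam 0) * cheb j (x i / L) + (- 1) * C j (x i)))"
    by (intro qbound_sum) auto
  then show ?thesis unfolding eq by (simp add: mult_ac add.commute)
qed

end

subsection \<open>Choice of the parameters\<close>

lemma cheb_le_power:
  assumes "1 \<le> x" "x \<le> (\<rho> + 1 / \<rho>) / 2" "1 \<le> \<rho>" shows "cheb k x \<le> \<rho> ^ k"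
proof -
  have "cheb k x \<le> (\<rho> ^ k + 1 / \<rho> ^ k) / 2"
    using cheb_mono[OF assms(1,2), of k] cheb_Joukowsky[of \<rho> k] assms by simp
  moreover have "1 \<le> \<rho> ^ k" using assms by simp
  then have "1 / \<rho> ^ k \<le> \<rho> ^ k" by (meson divide_le_eq_1_pos dual_order.trans less_le_trans zero_less_one)
  ultimately show ?thesis by simp
qed

lemma one_plus_power_le:
  fixes y :: real
  assumes "0 \<le> y" "real k * y \<le> 1" shows "(1 + y) ^ k \<le> 1 + 2 * (real k * y)"
proof -
  have "(1 + y) ^ k \<le> exp y ^ k" using assms by (intro power_mono exp_ge_add_one_self) auto
  also have "\<dots> = exp (real k * y)" by (simp add: exp_of_nat_mult)
  also have "\<dots> \<le> 1 + real k * y + (real k * y)\<^sup>2" using assms by (intro exp_bound) auto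
  also have "(real k * y)\<^sup>2 \<le> real k * y" unfolding power2_eq_square
    using assms by (intro mult_left_le_one_le) auto
  finally show ?thesis by linarith
qed

lemma ex_sos_kernel:
  fixes r d :: nat and w :: real
  defines "w \<equiv> ln (real r) / real r"
  assumes r: "100 \<le> r" and d: "1 \<le> d" and dw: "real d powr (5/2) * w \<le> 1 / 150"
  obtains L :: real and N :: nat and y :: "nat \<Rightarrow> real" and G :: "nat \<Rightarrow> real \<Rightarrow> real"
  where "1 \<le> L" "L \<le> ((1 + 2 * w) + 1 / (1 + 2 * w)) / 2" "\<forall>l. \<bar>y l\<bar> \<le> L"
    "\<forall>l. cheb_span (52 * r) (G l)"
    "\<forall>n i k. i < n \<longrightarrow> k \<le> d \<longrightarrow> qbound n (104 * r) ((7/2 * real d powr (9/2) + 14) * w / real r)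
       (\<lambda>x. cheb k (x i) - (\<Sum>l<N. cheb k (y l) * (G l (x i))\<^sup>2))"
proof -
  have ln1: "1 \<le> ln (real r)"
  proof -
    have "exp 1 \<le> real r" using exp_le r by linarith
    then show ?thesis using r by (simp add: ln_ge_iff)
  qed
  have lnr: "ln (real r) \<le> real r" using r ln_le_minus_one[of "real r"] by simp
  have w0: "0 < w" using ln1 r by (simp add: w_def)
  have w_r: "1 / real r \<le> w" using ln1 r by (simp add: w_def divide_right_mono)
  have "real d powr 2 \<le> real d powr (5/2)" using d by (intro powr_mono) auto
  then have "real d ^ 2 * w \<le> real d powr (5/2) * w" using w0 d by (intro mult_right_mono) auto
  then have d2w: "real d ^ 2 * w \<le> 1 / 150" using dw by linarith
  have d_d2: "real d \<le> real d ^ 2" using d by (intro self_le_power) auto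
  have "1 * w \<le> real d ^ 2 * w" using w0 d by (intro mult_right_mono) auto
  then have w1: "w \<le> 1 / 150" using d2w by linarith
  have "real d * (1 / real r) \<le> real d ^ 2 * w" using d_d2 w_r d by (intro mult_mono) auto
  then have "real d * (1 / real r) \<le> 1" using d2w by linarith
  then have dr: "real d \<le> real r" using r by (simp add: field_simps)

  \<comment> \<open>For \<open>\<rho>\<close> = exp s, \<open>h\<close> and \<open>\<sigma>\<close>
    below are cosh s - 1 and sinh s. Thus \<open>h\<close> is only of order w^2, while
    \<open>\<rho> ^ M\<close> is a high power of r because w = log r / r.\<close>
  define \<rho> where "\<rho> = 1 + w"
  define h where "h = w\<^sup>2 / (2 * \<rho>)"
  define \<sigma> where "\<sigma> = (\<rho> - 1 / \<rho>) / 2"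
  \<comment> \<open>2 M = 104 r is the degree of the univariate certificates, and M w / 2 = 26 log r
    sets the exponent in \<open>s_ge\<close>.\<close>
  define M where "M = 52 * r"
  define N where "N = 4 * M + 2"
  have \<rho>: "1 \<le> \<rho>" using w0 by (simp add: \<rho>_def)
  have h1: "1 + h = (\<rho> + 1 / \<rho>) / 2"
    using w0 by (simp add: h_def \<rho>_def field_simps power2_eq_square)
  have h0: "0 < h" using w0 \<rho> by (simp add: h_def)
  have hw: "h \<le> w\<^sup>2 / 2" unfolding h_def using \<rho> by (intro divide_left_mono) auto
  have w2: "w\<^sup>2 \<le> 1 / 150" using w1 w0 mult_mono[of w "1/150" w 1] by (simp add: power2_eq_square)
  have h_le: "h \<le> 1" using hw w2 by simp
  have \<sigma>2: "\<sigma>\<^sup>2 = (1 + h)\<^sup>2 - 1"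
    unfolding h1 \<sigma>_def using \<rho> by (simp add: field_simps power2_eq_square)
  have \<sigma>0: "0 \<le> \<sigma>" using \<rho> using mult_mono[of 1 \<rho> 1 \<rho>] by (simp add: \<sigma>_def field_simps)
  have \<sigma>w: "\<sigma> \<le> w"
  proof -
    have "\<sigma> = w * ((2 + w) / (2 * (1 + w)))"
      using w0 by (simp add: \<sigma>_def \<rho>_def field_simps power2_eq_square)
    also have "\<dots> \<le> w * 1" using w0 by (intro mult_left_mono) auto
    finally show ?thesis by simp
  qed
  obtain a where a: "\<And>z. cheb M (h / 2 + (1 + h / 2) * z) = (\<Sum>m\<le>M. a m * cheb m z)"
    using cheb_span_affine[of M "h / 2" "1 + h / 2"] by (auto simp: cheb_span_def)
  interpret K: cheb_kernel M N h a
    by unfold_locales (use r h0 h_le a in \<open>simp_all add: M_def N_def\<close>)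
  define s where "s = sqrt (K.lam 0)"
  have lam: "K.lam 0 = s\<^sup>2" "0 < s" using K.lam_0_pos by (auto simp: s_def)

  \<comment> \<open>From log(1 + w) >= w / 2 the peak is at least r^26 / 2, and the factor in
    \<open>K.cheb_peak_le\<close> costs r^3. The resulting r^23 is weakened to r^8.\<close>
  have s_ge: "real r ^ 8 \<le> s"
  proof -
    have "w * (1 / 2) \<le> w * (1 - w)" using w0 w1 by (intro mult_left_mono) auto
    also have "\<dots> \<le> ln \<rho>" unfolding \<rho>_def
      using ln_one_plus_pos_lower_bound[of w] w0 w1 by (simp add: algebra_simps power2_eq_square)
    finally have "real M * (w * (1 / 2)) \<le> real M * ln \<rho>" by (intro mult_left_mono) auto
    moreover have "real M * (w * (1 / 2)) = real 26 * ln (real r)"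
      using r by (simp add: M_def w_def)
    ultimately have "exp (real 26 * ln (real r)) \<le> exp (real M * ln \<rho>)" by simp
    then have "real r ^ 26 \<le> \<rho> ^ M" using r \<rho> by (simp only: exp_of_nat_mult exp_ln)
    also have "\<dots> \<le> 2 * cheb M (1 + h)" unfolding h1 using \<rho> by (simp add: cheb_Joukowsky)
    also have "\<dots> \<le> 4 * (real M + 1) * s" using K.cheb_peak_le unfolding s_def by linarith
    also have "\<dots> \<le> real r ^ 3 * s"
    proof -
      have "4 * (real M + 1) \<le> 10000 * real r" using r by (simp add: M_def)
      also have "\<dots> \<le> real r ^ 2 * real r" using r power_mono[of 100 "real r" 2] by (intro mult_right_mono) auto
      finally show ?thesis using lam by (intro mult_right_mono) (auto simp: power_numeral_reduce)
    qed
    finally have "real r ^ 3 * real r ^ 23 \<le> real r ^ 3 * s" by (simp flip: power_add)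
    then have "real r ^ 23 \<le> s" by (rule mult_left_le_imp_le) (use r in simp)
    moreover have "real r ^ 8 \<le> real r ^ 23" using r by (intro power_increasing) auto
    ultimately show ?thesis by linarith
  qed

  \<comment> \<open>The bound of \<open>K.second_moment_le\<close> divided by \<open>lam 0\<close>,
    with \<open>\<sigma>\<close> replaced by the larger \<open>w\<close>.\<close>
  define v where "v = w / (104 * real r) + (3 + 52 * ln (real r)) / K.lam 0"
  have v0: "0 < v" using w0 r ln1 K.lam_0_pos by (auto simp: v_def intro!: add_pos_pos)
  have v: "avg N (\<lambda>u. (1 - cos u) * (K.A u)\<^sup>2) \<le> v * K.lam 0"
  proof -
    have "\<sigma> / (2 * M) * K.lam 0 \<le> w / (104 * real r) * K.lam 0"
      using \<sigma>w K.lam_0_pos r by (intro mult_right_mono) (auto simp: M_def divide_right_mono)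
    moreover have "\<sigma> * M \<le> 52 * ln (real r)"
      using mult_right_mono[OF \<sigma>w, of "real M"] r by (simp add: M_def w_def)
    moreover have "v * K.lam 0 = w / (104 * real r) * K.lam 0 + (3 + 52 * ln (real r))"
      using K.lam_0_pos by (simp add: v_def field_simps)
    ultimately show ?thesis using K.second_moment_le[OF \<sigma>2 \<sigma>0] by linarith
  qed

  \<comment> \<open>L - 1 is at most w^2, whereas the Joukowsky image of 1 + 2 w exceeds 1 by 2 w^2
    / (1 + 2 w), which is at least w^2.\<close>
  have L_le: "K.L \<le> ((1 + 2 * w) + 1 / (1 + 2 * w)) / 2"
  proof -
    have "K.L - 1 = h / (1 - h / 2)" using h_le by (simp add: K.L_def field_simps)
    also have "\<dots> \<le> h / (1 / 2)" using h0 h_le by (intro divide_left_mono) auto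
    also have "\<dots> \<le> w\<^sup>2" using hw by simp
    also have "\<dots> \<le> w\<^sup>2 * (2 / (1 + 2 * w))"
      using w0 w1 mult_left_mono[of 1 "2 / (1 + 2 * w)" "w\<^sup>2"] by simp
    also have "\<dots> = ((1 + 2 * w) + 1 / (1 + 2 * w)) / 2 - 1"
      using w0 by (simp add: field_simps power2_eq_square)
    finally show ?thesis by simp
  qed

  define \<eta> where "\<eta> = (7/2 * real d powr (9/2) + 14) * w / real r"
  \<comment> \<open>The leading part is 16 d^3 v, of which w / (104 r) contributes (16/104) d^3 w /
    r, covered by the \<open>7/2\<close> term. The two remaining parts are each at most 1 / r^2,
    hence at most w / r, and fit into the \<open>14\<close>.\<close>
  have fine: "(real k + 1) * (2 * 2 * (v * ((real k)\<^sup>2 + 1) + 2 * (2 * M + 1) * (2 / sqrt (K.lam 0)))) \<le> \<eta>"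
    if "k \<le> d" for k
  proof -
    let ?\<mu> = "2 * (2 * real M + 1) * (2 / s)"
    have \<mu>0: "0 \<le> ?\<mu>" using lam by simp
    have "real k + 1 \<le> 2 * real d" using that d by linarith
    moreover have "(real k)\<^sup>2 \<le> (real d)\<^sup>2" "1 \<le> (real d)\<^sup>2"
      using that d by (auto intro!: power_mono)
    then have "(real k)\<^sup>2 + 1 \<le> 2 * (real d)\<^sup>2" by linarith
    then have "v * ((real k)\<^sup>2 + 1) \<le> v * (2 * (real d)\<^sup>2)" using v0 by (intro mult_left_mono) auto
    ultimately have "(real k + 1) * (2 * 2 * (v * ((real k)\<^sup>2 + 1) + ?\<mu>))
       \<le> (2 * real d) * (2 * 2 * (v * (2 * (real d)\<^sup>2) + ?\<mu>))"
      using v0 \<mu>0 lam by (intro mult_mono mult_left_mono add_mono) (auto intro!: add_nonneg_nonneg)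
    also have "\<dots> = 16 * real d ^ 3 * v + 8 * (real d * ?\<mu>)"
      by (simp add: algebra_simps power_numeral_reduce)
    also have "16 * real d ^ 3 * v = 16 / 104 * (real d ^ 3 * (w / real r)) + 16 * (real d ^ 3 * ((3 + 52 * ln (real r)) / s\<^sup>2))"
      using r by (simp add: v_def lam field_simps)
    also have "real d ^ 3 * ((3 + 52 * ln (real r)) / s\<^sup>2) \<le> real r ^ 3 * (100 * real r / (real r ^ 8)\<^sup>2)"
    proof (intro mult_mono frac_le power_mono)
      show "3 + 52 * ln (real r) \<le> 100 * real r" using lnr r by simp
      show "0 < (real r ^ 8)\<^sup>2" using r by simp
    qed (use dr s_ge lam ln1 in auto)
    also have "16 * (real r ^ 3 * (100 * real r / (real r ^ 8)\<^sup>2)) \<le> 1 / (real r)\<^sup>2"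
    proof -
      have "1600 \<le> real r ^ 10" using r power_mono[of 100 "real r" 10] by simp
      moreover have "(real r ^ 8)\<^sup>2 = real r ^ 3 * real r * (real r ^ 10 * (real r)\<^sup>2)"
        by (simp add: power_numeral_reduce)
      then have "real r ^ 3 * (100 * real r / (real r ^ 8)\<^sup>2) = 100 / (real r ^ 10 * (real r)\<^sup>2)"
        using r by (simp only: ; simp add: divide_simps)
      then have "16 * (real r ^ 3 * (100 * real r / (real r ^ 8)\<^sup>2)) = 1600 / real r ^ 10 * (1 / (real r)\<^sup>2)"
        by (simp only: times_divide_eq_right times_divide_eq_left divide_divide_eq_left; simp)
      moreover have "1600 / real r ^ 10 * (1 / (real r)\<^sup>2) \<le> 1 * (1 / (real r)\<^sup>2)"
        using \<open>1600 \<le> real r ^ 10\<close> r by (intro mult_right_mono) auto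
      ultimately show ?thesis by simp
    qed
    also have "real d * ?\<mu> \<le> real r * (1000 * real r * (1 / real r ^ 8))"
    proof -
      have "?\<mu> = (8 * real M + 4) * (1 / s)" by (simp add: field_simps)
      also have "\<dots> \<le> (1000 * real r) * (1 / real r ^ 8)"
        using r s_ge lam by (intro mult_mono frac_le) (auto simp: M_def)
      finally show ?thesis by (rule mult_mono[OF dr]) (use \<mu>0 in auto)
    qed
    also have "8 * (real r * (1000 * real r * (1 / real r ^ 8))) \<le> 1 / (real r)\<^sup>2"
    proof -
      have "8000 \<le> real r ^ 4" using r power_mono[of 100 "real r" 4] by simp
      moreover have "real r ^ 8 = real r * real r * (real r ^ 4 * (real r)\<^sup>2)"
        by (simp add: power_numeral_reduce)
      then have "real r * (1000 * real r * (1 / real r ^ 8)) = 1000 / (real r ^ 4 * (real r)\<^sup>2)"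
        using r by (simp only: ; simp add: divide_simps)
      then have "8 * (real r * (1000 * real r * (1 / real r ^ 8))) = 8000 / real r ^ 4 * (1 / (real r)\<^sup>2)"
        by (simp only: times_divide_eq_right times_divide_eq_left divide_divide_eq_left; simp)
      moreover have "8000 / real r ^ 4 * (1 / (real r)\<^sup>2) \<le> 1 * (1 / (real r)\<^sup>2)"
        using \<open>8000 \<le> real r ^ 4\<close> r by (intro mult_right_mono) auto
      ultimately show ?thesis by simp
    qed
    also have "real d ^ 3 * (w / real r) \<le> real d powr (9/2) * (w / real r)"
    proof -
      have "real d powr 3 \<le> real d powr (9/2)" using d by (intro powr_mono) auto
      then show ?thesis using d w0 by (intro mult_right_mono) auto
    qed
    also have "16 / 104 * (real d powr (9/2) * (w / real r)) + 1 / (real r)\<^sup>2 + 1 / (real r)\<^sup>2 \<le> \<eta>"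
    proof -
      have "1 / (real r)\<^sup>2 \<le> w / real r"
        using w_r r divide_right_mono[OF w_r, of "real r"] by (simp add: power2_eq_square)
      moreover have "\<eta> = 7/2 * (real d powr (9/2) * (w / real r)) + 14 * (w / real r)"
        by (simp add: \<eta>_def add_divide_distrib distrib_right)
      moreover have "0 \<le> real d powr (9/2) * (w / real r)" "0 \<le> w / real r" using w0 by auto
      ultimately show ?thesis by linarith
    qed
    finally show ?thesis by (simp add: s_def add.commute)
  qed

  define y where "y = (\<lambda>l. K.L * cos (node N l))"
  \<comment> \<open>The normalisation moves inside the square, so each weight is literally the
    square of a polynomial.\<close>
  define G where "G = (\<lambda>l x. sqrt (2 / (real N * K.lam 0)) * K.H (node N l) x)"
  have G2: "(G l x)\<^sup>2 = K.wt l x" for l x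
    using K.lam_0_pos by (simp add: G_def K.wt_def power_mult_distrib)
  show ?thesis
  proof (rule that[of K.L y G N]; (intro allI impI)?)
    show "1 \<le> K.L" using K.L_gt_1 by simp
    show "\<bar>y l\<bar> \<le> K.L" for l
      using K.L_gt_1 mult_left_mono[OF abs_cos_le_one[of "node N l"], of K.L] by (simp add: y_def abs_mult)
    show "cheb_span (52 * r) (G l)" for l
      using cheb_span_cmult[OF K.cheb_span_H] by (simp add: G_def M_def)
    fix n i k :: nat assume i: "i < n" and k: "k \<le> d"
    \<comment> \<open>The aim is T_k(L) <= 2, the value taken for \<open>\<tau>\<close> in
      \<open>K.qbound_kernel\<close>.\<close>
    have "cheb k K.L \<le> (1 + 2 * w) ^ k" using K.L_gt_1 L_le w0 by (intro cheb_le_power) auto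
    also have "\<dots> \<le> 1 + 2 * (real k * (2 * w))"
    proof (rule one_plus_power_le)
      have "real k * w \<le> (real d)\<^sup>2 * w" using k d_d2 w0 by (intro mult_right_mono) auto
      then show "real k * (2 * w) \<le> 1" using d2w by simp
    qed (use w0 in simp)
    also have "\<dots> \<le> 2"
    proof -
      have "real k * w \<le> (real d)\<^sup>2 * w" using k d_d2 w0 by (intro mult_right_mono) auto
      then show ?thesis using d2w by simp
    qed
    finally have "qbound n (2 * M)
       ((real k + 1) * (2 * 2 * (v * ((real k)\<^sup>2 + 1) + 2 * (2 * M + 1) * (2 / sqrt (K.lam 0)))))
       (\<lambda>x. cheb k (x i) - (\<Sum>l<N. cheb k (y l) * K.wt l (x i)))"
      unfolding y_def using k dr by (intro K.qbound_kernel i v v0) (auto simp: M_def)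
    then show "qbound n (104 * r) ((7/2 * real d powr (9/2) + 14) * w / real r)
       (\<lambda>x. cheb k (x i) - (\<Sum>l<N. cheb k (y l) * (G l (x i))\<^sup>2))"
      unfolding G2 \<eta>_def[symmetric] by (rule qbound_mono[OF _ _ fine[OF k]]) (simp add: M_def)
  qed (rule L_le)
qed

subsection \<open>Positivity on a slightly larger cube\<close>

lemma mindex_le: "\<alpha> \<in> mindex n d \<Longrightarrow> i < n \<Longrightarrow> \<alpha> i \<le> d"
  using member_le_sum[of i "{..<n}" \<alpha>] by (auto simp: mindex_def)

text \<open>Restricting to a line through the origin makes dilation of the cube a one-variable
  question.\<close>

lemma cheb_span_chebpoly_ray: "cheb_span d (\<lambda>s. chebpoly n d c (\<lambda>i. s * x i))"
proof -
  have "cheb_span (\<Sum>i<m. \<alpha> i) (\<lambda>s. \<Prod>i<m. cheb (\<alpha> i) (0 + x i * s))" for m :: nat and \<alpha>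
  proof (induction m)
    case (Suc m)
    show ?case using cheb_span_mult[OF Suc cheb_span_affine[of "\<alpha> m" 0 "x m"]] by simp
  qed (simp add: cheb_span_const)
  then have "cheb_span (\<Sum>i<n. \<alpha> i) (\<lambda>s. chebT n \<alpha> (\<lambda>i. s * x i))" for \<alpha>
    by (simp add: chebT_def mult.commute)
  then have "cheb_span d (\<lambda>s. chebT n \<alpha> (\<lambda>i. s * x i))" if "\<alpha> \<in> mindex n d" for \<alpha>
    by (rule cheb_span_mono) (use that in \<open>auto simp: mindex_def\<close>)
  then show ?thesis unfolding chebpoly_def by (intro cheb_span_sum cheb_span_cmult)
qed

lemma abs_chebT_le_1: "x \<in> cube n \<Longrightarrow> \<bar>chebT n \<alpha> x\<bar> \<le> 1"
  unfolding chebT_def abs_prod by (intro prod_le_1 conjI abs_cheb_le_1 abs_leI) (auto simp: cube_def)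

text \<open>Write y = L x with x in the cube and g(s) = f(s x). The coefficients of g are at most 2
  \<open>fmax\<close>, and T_k(L) - T_k(1) <= 4 d w. Summing over k shows |g(L) - g(1)| <=
  \<open>fmin\<close>, while g(1) >= \<open>fmin\<close>.\<close>

lemma chebpoly_nonneg_dilated_cube:
  assumes bnd: "\<And>x. x \<in> cube n \<Longrightarrow> fmin \<le> chebpoly n d c x \<and> chebpoly n d c x \<le> fmax"
    and f0: "0 < fmin" and w: "0 \<le> w" and dw: "2 * real d * w \<le> 1"
    and margin: "8 * real d * (real d + 1) * w * fmax \<le> fmin"
    and L: "1 \<le> L" "L \<le> ((1 + 2 * w) + 1 / (1 + 2 * w)) / 2"
    and y: "\<And>i. i < n \<Longrightarrow> \<bar>y i\<bar> \<le> L"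
  shows "0 \<le> chebpoly n d c y"
proof -
  define x where "x = (\<lambda>i. y i / L)"
  have x: "\<bar>x i\<bar> \<le> 1" if "i < n" for i using y[OF that] L by (simp add: x_def)
  define g where "g = (\<lambda>s. chebpoly n d c (\<lambda>i. s * x i))"
  have g_bnd: "fmin \<le> g s \<and> g s \<le> fmax" if "\<bar>s\<bar> \<le> 1" for s
  proof -
    have "\<bar>s * x i\<bar> \<le> 1" if "i < n" for i
      using x[OF that] \<open>\<bar>s\<bar> \<le> 1\<close> by (simp add: abs_mult mult_le_one)
    then show ?thesis unfolding g_def by (intro bnd) (auto simp: cube_def abs_le_iff)
  qed
  obtain a where a: "\<And>s. g s = (\<Sum>k\<le>d. a k * cheb k s)"
    using cheb_span_chebpoly_ray[of d n c x] by (auto simp: cheb_span_def g_def)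
  have "\<bar>g s\<bar> \<le> fmax" if "\<bar>s\<bar> \<le> 1" for s using g_bnd[OF that] f0 by auto
  then have a_le: "\<bar>a k\<bar> \<le> 2 * fmax" if "k \<le> d" for k using cheb_coeff_le[OF a _ that] by blast
  have fmax: "0 \<le> fmax" using g_bnd[of 0] f0 by simp
  have "\<bar>a k * (cheb k L - cheb k 1)\<bar> \<le> 2 * fmax * (4 * real d * w)" if "k \<in> {..d}" for k
  proof -
    have "cheb k L \<le> (1 + 2 * w) ^ k" using L w by (intro cheb_le_power) auto
    also have "\<dots> \<le> (1 + 2 * w) ^ d" using that w by (intro power_increasing) auto
    also have "\<dots> \<le> 1 + 2 * (real d * (2 * w))" using w dw by (intro one_plus_power_le) auto
    finally have "cheb k L - cheb k 1 \<le> 4 * real d * w" using cheb_ge_1[of 1 k] by simp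
    moreover have "cheb k 1 \<le> cheb k L" using cheb_mono[of 1 L k] L by simp
    ultimately show ?thesis unfolding abs_mult using a_le that fmax by (intro mult_mono) auto
  qed
  then have "\<bar>\<Sum>k\<le>d. a k * (cheb k L - cheb k 1)\<bar> \<le> (\<Sum>k\<le>d. 2 * fmax * (4 * real d * w))"
    by (rule order_trans[OF sum_abs sum_mono])
  also have "\<dots> = 8 * real d * (real d + 1) * w * fmax" by (simp add: algebra_simps)
  finally have "\<bar>g L - g 1\<bar> \<le> fmin" using margin unfolding a by (simp add: sum_subtractf right_diff_distrib)
  moreover have "g L = chebpoly n d c y" using L by (simp add: g_def x_def)
  moreover have "fmin \<le> g 1" using g_bnd[of 1] by simp
  ultimately show ?thesis by linarith
qed

subsection \<open>The certificate\<close>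

lemma sos_sum:
  assumes "\<And>i. i \<in> I \<Longrightarrow> sos n r (f i)" shows "sos n r (\<lambda>x. \<Sum>i\<in>I. f i x)"
  using assms by (induction I rule: infinite_finite_induct) (auto intro: sos_zero sos_add)

text \<open>Multiplying out over the coordinates gives a sum over tuples of nodes: the coefficient
  is the polynomial evaluated at the tuple, and the product of squares is again a square.\<close>

lemma sos_kernel_image:
  fixes N :: nat
  assumes y: "\<And>g. g \<in> {..<n} \<rightarrow>\<^sub>E {..<N} \<Longrightarrow> 0 \<le> chebpoly n d c (\<lambda>i. y (g i))"
    and G: "\<And>l. cheb_span D (G l)"
  shows "sos n (2 * (n * D)) (\<lambda>x. \<Sum>\<alpha>\<in>mindex n d. c \<alpha> * (\<Prod>i<n. \<Sum>l<N. cheb (\<alpha> i) (y l) * (G l (x i))\<^sup>2))"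
proof -
  let ?I = "{..<n} \<rightarrow>\<^sub>E {..<N}"
  have "(\<Sum>\<alpha>\<in>mindex n d. c \<alpha> * (\<Prod>i<n. \<Sum>l<N. cheb (\<alpha> i) (y l) * (G l (x i))\<^sup>2))
     = (\<Sum>g\<in>?I. chebpoly n d c (\<lambda>i. y (g i)) * (\<Prod>i<n. G (g i) (x i))\<^sup>2)" for x :: "nat \<Rightarrow> real"
  proof -
    have "(\<Sum>\<alpha>\<in>mindex n d. c \<alpha> * (\<Prod>i<n. \<Sum>l<N. cheb (\<alpha> i) (y l) * (G l (x i))\<^sup>2))
      = (\<Sum>\<alpha>\<in>mindex n d. \<Sum>g\<in>?I. c \<alpha> * chebT n \<alpha> (\<lambda>i. y (g i)) * (\<Prod>i<n. G (g i) (x i))\<^sup>2)"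
      by (subst prod_sum_PiE)
        (auto simp: chebT_def prod.distrib sum_distrib_left mult.assoc prod_power_distrib)
    also have "\<dots> = (\<Sum>g\<in>?I. \<Sum>\<alpha>\<in>mindex n d. c \<alpha> * chebT n \<alpha> (\<lambda>i. y (g i)) * (\<Prod>i<n. G (g i) (x i))\<^sup>2)"
      by (rule sum.swap)
    finally show ?thesis by (simp add: chebpoly_def sum_distrib_right)
  qed
  moreover have "sos n (2 * (n * D)) (\<lambda>x. \<Sum>g\<in>?I. chebpoly n d c (\<lambda>i. y (g i)) * (\<Prod>i<n. G (g i) (x i))\<^sup>2)"
    by (intro sos_sum sos_cmult sos_square polyfun_prod polyfun_cheb_span G y) auto
  ultimately show ?thesis by simp
qed

text \<open>A certified bound is symmetric in sign, so the sign of each coefficient can be absorbed;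
  this is how the Chebyshev 1-norm enters.\<close>

lemma qmod_sum_abs_coeff:
  assumes "\<And>\<alpha>. \<alpha> \<in> I \<Longrightarrow> qbound n D E (p \<alpha>)"
  shows "qmod n (2 * D) (\<lambda>x. (\<Sum>\<alpha>\<in>I. \<bar>c \<alpha>\<bar>) * E + (\<Sum>\<alpha>\<in>I. c \<alpha> * p \<alpha> x))"
proof -
  have "qmod n (2 * D) (\<lambda>x. \<bar>c \<alpha>\<bar> * (1 * E - (- sgn (c \<alpha>)) * p \<alpha> x))" if "\<alpha> \<in> I" for \<alpha>
    using assms[OF that] by (intro qmod_cmult qbound_imp_qmod qbound_cmult) (auto simp: sgn_if)
  then have "qmod n (2 * D) (\<lambda>x. \<Sum>\<alpha>\<in>I. \<bar>c \<alpha>\<bar> * (1 * E - (- sgn (c \<alpha>)) * p \<alpha> x))" by (rule qmod_sum)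
  moreover have "\<bar>c \<alpha>\<bar> * (1 * E - (- sgn (c \<alpha>)) * p \<alpha> x) = \<bar>c \<alpha>\<bar> * E + c \<alpha> * p \<alpha> x" for \<alpha> x
    by (simp add: sgn_if algebra_simps)
  ultimately show ?thesis by (simp add: sum.distrib sum_distrib_right)
qed

lemma mindex_trivial:
  assumes "n = 0 \<or> d = 0" shows "mindex n d = {\<lambda>_. 0}"
  using assms by (fastforce simp: mindex_def not_less[symmetric])

theorem theorem7:
  fixes n d r :: nat and c :: "(nat \<Rightarrow> nat) \<Rightarrow> real" and fmin fmax :: real
  assumes fmin_def: "fmin = (INF x\<in>cube n. chebpoly n d c x)"
      and fmax_def: "fmax = (SUP x\<in>cube n. chebpoly n d c x)"
      and pos: "\<forall>x\<in>cube n. chebpoly n d c x > 0"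
      and "0 < fmin" and "fmin < fmax"
      and "r \<ge> 2"
      and "real r / ln (real r) \<ge> 10 * sqrt 35 * (1 + 1 / sqrt 2) * real d powr (5/2)"
      and "real r / ln (real r) \<ge> 150 * real d powr (5/2) * fmax / fmin"
  shows "qmod n (2 * n * (104 * r))
           (\<lambda>x. chebpoly n d c x + exp 1 * real n * (7/2 * real d powr (9/2) + 14)
                   * cheb_norm1 n d c * ln (real r) / (real r)^2)"
proof -
  define w where "w = ln (real r) / real r"
  define \<eta> where "\<eta> = (7/2 * real d powr (9/2) + 14) * w / real r"
  \<comment> \<open>The claimed error divided by the Chebyshev 1-norm, that is, the error allowed
    for a single T_alpha.\<close>
  define E where "E = exp 1 * (real n * \<eta>)"
  let ?D = "n * (104 * r)"
  have cube0: "(\<lambda>_. 0) \<in> cube n" by (simp add: cube_def)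
  \<comment> \<open>If \<open>n\<close> or \<open>d\<close> were 0 the polynomial would be constant,
    against \<open>fmin < fmax\<close>.\<close>
  have nd: "1 \<le> n" "1 \<le> d"
  proof -
    have "\<not> (n = 0 \<or> d = 0)"
    proof
      assume that: "n = 0 \<or> d = 0"
      have "chebpoly n d c x = c (\<lambda>_. 0)" for x
        by (simp add: chebpoly_def mindex_trivial[OF that] chebT_def)
      moreover have "cube n \<noteq> {}" using cube0 by blast
      ultimately have "fmin = fmax" unfolding fmin_def fmax_def by simp
      with \<open>fmin < fmax\<close> show False by simp
    qed
    then show "1 \<le> n" "1 \<le> d" by simp_all
  qed
  have bnd: "fmin \<le> chebpoly n d c x \<and> chebpoly n d c x \<le> fmax" if "x \<in> cube n" for x
  proof
    have "bdd_below (chebpoly n d c ` cube n)" using pos by (auto intro!: bdd_belowI2[of _ 0] less_imp_le)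
    then show "fmin \<le> chebpoly n d c x" unfolding fmin_def using that by (intro cINF_lower) auto
    have "chebpoly n d c x \<le> cheb_norm1 n d c" if "x \<in> cube n" for x
      unfolding chebpoly_def cheb_norm1_def
    proof (rule sum_mono)
      fix \<alpha>
      have "\<bar>c \<alpha>\<bar> * \<bar>chebT n \<alpha> x\<bar> \<le> \<bar>c \<alpha>\<bar> * 1" using abs_chebT_le_1[OF that] by (intro mult_left_mono) auto
      then show "c \<alpha> * chebT n \<alpha> x \<le> \<bar>c \<alpha>\<bar>" unfolding abs_mult[symmetric] by simp
    qed
    then have "bdd_above (chebpoly n d c ` cube n)" by (rule bdd_aboveI2)
    then show "chebpoly n d c x \<le> fmax" unfolding fmax_def using that by (intro cSUP_upper) auto
  qed
  have lnr: "0 < ln (real r)" using \<open>r \<ge> 2\<close> by simp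
  have d25: "1 \<le> real d powr (5/2)" "(real d)\<^sup>2 \<le> real d powr (5/2)"
    using nd powr_mono[of 2 "5/2" "real d"] by (auto simp: ge_one_powr_ge_zero)
  have cond: "150 * (real d powr (5/2) * w) * fmax \<le> fmin"
    using assms(8) lnr \<open>0 < fmin\<close> \<open>r \<ge> 2\<close> by (simp add: w_def field_simps)
  have w0: "0 < w" using lnr \<open>r \<ge> 2\<close> by (simp add: w_def)
  \<comment> \<open>\<open>fmin < fmax\<close> turns the ratio condition into a bound on
    \<open>w\<close> alone.\<close>
  have "150 * (real d powr (5/2) * w) * fmin \<le> 150 * (real d powr (5/2) * w) * fmax"
    using w0 \<open>fmin < fmax\<close> by (intro mult_left_mono) auto
  with cond have "150 * (real d powr (5/2) * w) * fmin \<le> 1 * fmin" by simp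
  then have dw: "real d powr (5/2) * w \<le> 1 / 150" using \<open>0 < fmin\<close> by simp
  \<comment> \<open>w <= 1/150 means r >= 150 log r, and log r >= log 2 >= 2/3.\<close>
  have r100: "100 \<le> r"
  proof -
    have "1 * w \<le> real d powr (5/2) * w" using d25 w0 by (intro mult_right_mono) auto
    then have "w \<le> 1 / 150" using dw by simp
    then have "150 * ln (real r) \<le> real r" using \<open>r \<ge> 2\<close> by (simp add: w_def field_simps)
    moreover have "ln 2 \<le> ln (real r)" using \<open>r \<ge> 2\<close> by simp
    ultimately have "100 \<le> real r" using ln2_ge_two_thirds by linarith
    then show ?thesis by simp
  qed
  obtain L :: real and N :: nat and y G where K: "1 \<le> L" "L \<le> ((1 + 2 * w) + 1 / (1 + 2 * w)) / 2" "\<forall>l. \<bar>y l\<bar> \<le> L"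
    "\<forall>l. cheb_span (52 * r) (G l)"
    "\<forall>n i k. i < n \<longrightarrow> k \<le> d \<longrightarrow> qbound n (104 * r) \<eta>
       (\<lambda>x. cheb k (x i) - (\<Sum>l<N. cheb k (y l) * (G l (x i))\<^sup>2))"
    by (rule ex_sos_kernel[OF r100 nd(2) dw[unfolded w_def], folded w_def, folded \<eta>_def]) (rule that)
  have T: "qbound n (104 * r) 1 (\<lambda>x. cheb (\<alpha> i) (x i))" if "\<alpha> \<in> mindex n d" "i < n" for \<alpha> i
  proof -
    have "real d powr (5/2) * (1 / real r) \<le> real d powr (5/2) * w"
    proof -
      have "exp 1 \<le> real r" using exp_le r100 by linarith
      then have "1 \<le> ln (real r)" using r100 by (simp add: ln_ge_iff)
      then show ?thesis by (intro mult_left_mono) (auto simp: w_def divide_right_mono)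
    qed
    then have "real d powr (5/2) * (1 / real r) \<le> 1" using dw by linarith
    then have "real d powr (5/2) \<le> real r" using r100 by (simp add: field_simps)
    moreover have "real d \<le> (real d)\<^sup>2" using nd by (intro self_le_power) auto
    ultimately have "real d \<le> real r" using d25 by linarith
    then have "d \<le> r" by simp
    then have "\<alpha> i \<le> 104 * r" using mindex_le[OF that] by simp
    then show ?thesis using qbound_cheb[OF that(2), of 1] by simp
  qed
  have D1: "1 \<le> 104 * r" using r100 by simp
  have \<eta>: "0 < \<eta>" using w0 r100 nd by (auto simp: \<eta>_def intro!: divide_pos_pos mult_pos_pos add_nonneg_pos)
  have goal: "(\<lambda>x. chebpoly n d c x + exp 1 * real n * (7/2 * real d powr (9/2) + 14)
                   * cheb_norm1 n d c * ln (real r) / (real r)^2)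
    = (\<lambda>x. (\<Sum>\<alpha>\<in>mindex n d. \<bar>c \<alpha>\<bar>) * E + (\<Sum>\<alpha>\<in>mindex n d. c \<alpha> * chebT n \<alpha> x))"
    by (simp add: chebpoly_def cheb_norm1_def E_def \<eta>_def w_def power2_eq_square mult_ac add.commute)
  show ?thesis
  proof (cases "real n * \<eta> \<le> 1")
    \<comment> \<open>The allowed error exceeds 1, so the certificate for |T_alpha| <= 1 suffices
      and no kernel is used.\<close>
    case False
    have "qbound n ?D E (chebT n \<alpha>)" if "\<alpha> \<in> mindex n d" for \<alpha>
    proof -
      have "exp 1 * 1 \<le> E" unfolding E_def using False by (intro mult_left_mono) auto
      then have "1 \<le> E" using exp_ge_add_one_self[of 1] by linarith
      moreover have "qbound n ?D (1 ^ n) (chebT n \<alpha>)"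
        unfolding chebT_def[abs_def] by (intro qbound_prod T that D1 nd)
      ultimately show ?thesis by (auto intro: qbound_mono)
    qed
    then have "qmod n (2 * ?D) (\<lambda>x. (\<Sum>\<alpha>\<in>mindex n d. \<bar>c \<alpha>\<bar>) * E
        + (\<Sum>\<alpha>\<in>mindex n d. c \<alpha> * chebT n \<alpha> x))"
      by (rule qmod_sum_abs_coeff)
    then show ?thesis unfolding goal by (simp only: mult.assoc)
  next
    \<comment> \<open>Here (1 + \<open>\<eta>\<close>)^n <= exp(n \<open>\<eta>\<close>) <= e, which
      is where the factor e in the error comes from.\<close>
    case True
    define P where "P = (\<lambda>\<alpha> x. \<Prod>i<n. \<Sum>l<N. cheb (\<alpha> i) (y l) * (G l (x i))\<^sup>2)"
    have "(1 + \<eta>) ^ n \<le> exp \<eta> ^ n" using \<eta> by (intro power_mono exp_ge_add_one_self) auto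
    also have "\<dots> \<le> exp 1" using True by (simp flip: exp_of_nat_mult)
    finally have "real n * \<eta> * (1 + \<eta>) ^ n \<le> real n * \<eta> * exp 1" using \<eta> by (intro mult_left_mono) auto
    then have e: "real n * \<eta> * (1 + \<eta>) ^ n \<le> E" by (simp add: E_def mult_ac)
    have "qbound n ?D E (\<lambda>x. chebT n \<alpha> x - P \<alpha> x)" if "\<alpha> \<in> mindex n d" for \<alpha>
    proof -
      have "qbound n ?D (real n * \<eta> * (1 + \<eta>) ^ n) (\<lambda>x. chebT n \<alpha> x - P \<alpha> x)"
        unfolding chebT_def P_def
        by (intro qbound_prod_diff T[OF that] K(5)[rule_format] D1 \<eta> nd mindex_le[OF that])
      then show ?thesis using e by (auto intro: qbound_mono)
    qed
    then have 1: "qmod n (2 * ?D) (\<lambda>x. (\<Sum>\<alpha>\<in>mindex n d. \<bar>c \<alpha>\<bar>) * E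
        + (\<Sum>\<alpha>\<in>mindex n d. c \<alpha> * (chebT n \<alpha> x - P \<alpha> x)))"
      by (rule qmod_sum_abs_coeff)
    \<comment> \<open>The nodes lie in the cube dilated by \<open>L\<close>; \<open>cond\<close>
      supplies the margin, since d and d^2 are both at most d^(5/2).\<close>
    have "0 \<le> chebpoly n d c (\<lambda>i. y (g i))" for g
    proof (rule chebpoly_nonneg_dilated_cube[OF bnd \<open>0 < fmin\<close> _ _ _ K(1,2)])
      have "real d * 1 \<le> real d * real d" using nd by (intro mult_left_mono) auto
      then have d2: "real d \<le> real d powr (5/2)" using d25 by (simp add: power2_eq_square)
      have "real d * w \<le> real d powr (5/2) * w" using d2 w0 by (intro mult_right_mono) auto
      then show "2 * real d * w \<le> 1" using dw by simp
      have "8 * real d * (real d + 1) \<le> 150 * real d powr (5/2)"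
        using d2 d25 by (simp add: algebra_simps power2_eq_square)
      then have "8 * real d * (real d + 1) * (w * fmax) \<le> 150 * real d powr (5/2) * (w * fmax)"
        using w0 \<open>0 < fmin\<close> \<open>fmin < fmax\<close> by (intro mult_right_mono) auto
      then show "8 * real d * (real d + 1) * w * fmax \<le> fmin" using cond by (simp only: mult.assoc)
    qed (use w0 K(3) in auto)
    then have "sos n (2 * (n * (52 * r))) (\<lambda>x. \<Sum>\<alpha>\<in>mindex n d. c \<alpha> * P \<alpha> x)"
      unfolding P_def by (intro sos_kernel_image K(4)[rule_format])
    then have "qmod n (2 * ?D) (\<lambda>x. \<Sum>\<alpha>\<in>mindex n d. c \<alpha> * P \<alpha> x)"
      by (intro qmod_sos) (elim sos_mono, simp)
    \<comment> \<open>The error plus f - F, with F the kernel image, lies in the module by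
      \<open>1\<close>; adding the sum of squares F restores f.\<close>
    from qmod_add[OF 1 this] show ?thesis
      unfolding goal by (simp add: right_diff_distrib sum_subtractf mult.assoc)
  qed
qed

end
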